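(* Let $(E,\varphi)$ be a product system of graphs over a quasi-lattice ordered semigroup $P$. Then the product system $X(E)$ of Cuntz-Krieger bimodules is compactly aligned if and only if $(E,\varphi)$ is finitely aligned.
   Context: **Quasi-lattice order.** Let $P$ be a subsemigroup of a group $G$ with $P\cap P^{-1}=\{e\}$. Then $g\le h\iff g^{-1}h\in P$ defines a partial order on $G$; $P$ (strictly, $(G,P)$) is quasi-lattice ordered if every finite subset of $G$ with an upper bound in $P$ has a least upper bound in $P$. For $p,q\in P$ with a common upper bound in $P$, $p\vee q$ denotes their least upper bound; otherwise $p\vee q=\infty$. **Product systems of graphs.** A (directed) graph $(E^0,E^1,r,s)$ has countable vertex set $E^0$, countable edge set $E^1$ and range and source maps $r,s:E^1\to E^0$. For graphs $E,F$ with the same vertex set $E^0$, $E\times_{E^0}F$ is the graph with vertex set $E^0$, edge set $\{(\lambda,\mu):\lambda\in E^1,\mu\in F^1,r(\lambda)=s(\mu)\}$, $s(\lambda,\mu)=s(\lambda)$, $r(\lambda,\mu)=r(\mu)$. A product system $(E,\varphi)$ of graphs over a countable semigroup $P$ with identity $e$ consists of graphs $E_p=(E^0,E_p^1,r_p,s_p)$, $p\in P$, with common vertex set $E^0$ and disjoint edge sets, and graph isomorphisms $\varphi_{p,q}:E_p\times_{E^0}E_q\to E_{pq}$ (identity on vertices) with $\varphi_{pq,r}(\varphi_{p,q}(\lambda,\mu),\nu)=\varphi_{p,qr}(\lambda,\varphi_{q,r}(\mu,\nu))$ whenever defined, and $E_e=(E^0,E^0,\mathrm{id},\mathrm{id})$.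 Put $E^1:=\bigcup_pE_p^1$, $d(\lambda)=p$ if $\lambda\in E_p^1$, and write $\lambda\mu:=\varphi_{p,q}(\lambda,\mu)$. Each $\gamma\in E_{pq}^1$ factors uniquely as $\gamma=\lambda\mu$ with $d(\lambda)=p$, $d(\mu)=q$; write $\gamma(e,p):=\lambda$. **Finite alignment.** For $\mu\in E_p^1$, $\nu\in E_q^1$, $\mathrm{MCE}(\mu,\nu)$ is the set of $\gamma\in E^1$ with $d(\gamma)=p\vee q$, $\gamma(e,p)=\mu$ and $\gamma(e,q)=\nu$ (empty if $p\vee q=\infty$). $(E,\varphi)$ is finitely aligned if $\mathrm{MCE}(\mu,\nu)$ is finite (possibly empty) for all $\mu,\nu\in E^1$. **Bimodules.** For a graph $E$, the Cuntz-Krieger bimodule $X(E)$ is the set of functions $x:E^1\to\mathbb{C}$ such that $v\mapsto\sum_{r(\lambda)=v}|x(\lambda)|^2$ is finite and vanishes at infinity on $E^0$; it is a Hilbert bimodule over $C_0(E^0)$ with $(x\cdot a)(\lambda)=x(\lambda)a(r(\lambda))$, $(a\cdot x)(\lambda)=a(s(\lambda))x(\lambda)$, $\langle x,y\rangle(v)=\sum_{r(\lambda)=v}\overline{x(\lambda)}y(\lambda)$. For a product system $(E,\varphi)$, $X(E)=\bigsqcup_pX_p$ with $X_p=X(E_p)$ and multiplication $X_p\times X_q\to X_{pq}$ given by $(xy)(\lambda\mu)=x(\lambda)y(\mu)$ for $(\lambda,\mu)\in(E_p\times_{E^0}E_q)^1$; this induces isomorphisms $X_p\otimes_{C_0(E^0)}X_q\cong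 X_{pq}$. **Compact alignment.** Let $\mathcal{L}(Y)$ and $\mathcal{K}(Y)$ be the adjointable and compact (closed span of $\Theta_{x,y}:z\mapsto x\cdot\langle y,z\rangle$) operators on a Hilbert module $Y$. For $p\vee q<\infty$ and $S\in\mathcal{L}(X_p)$, $S_p^{p\vee q}\in\mathcal{L}(X_{p\vee q})$ is the operator characterised by $S_p^{p\vee q}(xy)=(Sx)y$ for $x\in X_p$, $y\in X_{p^{-1}(p\vee q)}$. The product system is compactly aligned if, whenever $p\vee q<\infty$, $S\in\mathcal{K}(X_p)$ and $T\in\mathcal{K}(X_q)$ imply $S_p^{p\vee q}T_q^{p\vee q}\in\mathcal{K}(X_{p\vee q})$. *)

theory Defs
  imports "HOL-Analysis.Analysis" "HOL-Algebra.Group" "Graph_Theory.Digraph"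
begin

section \<open>Quasi-lattice ordered semigroups\<close>

definition left_order :: "('g, 'm) monoid_scheme \<Rightarrow> 'g set \<Rightarrow> 'g gorder" where
  "left_order G P =
    \<lparr>carrier = carrier G, eq = (=), le = (\<lambda>g h. inv\<^bsub>G\<^esub> g \<otimes>\<^bsub>G\<^esub> h \<in> P)\<rparr>"

definition upper_bounds_in :: "('g, 'm) monoid_scheme \<Rightarrow> 'g set \<Rightarrow> 'g set \<Rightarrow> 'g set" where
  "upper_bounds_in G P A = Upper (left_order G P) A \<inter> P"

text \<open>A least upper bound in \<open>P\<close> is least among the upper bounds lying in \<open>P\<close>; it need not be a
  least upper bound in \<open>G\<close> (consider \<open>{-1}\<close> in the pair of the integers and the natural numbers).\<close>

definition is_lub_in :: "('g, 'm) monoid_scheme \<Rightarrow> 'g set \<Rightarrow> 'g set \<Rightarrow> 'g \<Rightarrow> bool" where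
  "is_lub_in G P A u \<longleftrightarrow> least (left_order G P) u (upper_bounds_in G P A)"

locale quasi_lattice_ordered = group G for G (structure) +
  fixes P :: "'a set"
  assumes P_subset: "P \<subseteq> carrier G"
    and P_mult_closed: "\<lbrakk>p \<in> P; q \<in> P\<rbrakk> \<Longrightarrow> p \<otimes> q \<in> P"
    and P_inter_inv: "P \<inter> m_inv G ` P = {\<one>}"
    and lub_exists:
      "\<lbrakk>finite A; A \<subseteq> carrier G; upper_bounds_in G P A \<noteq> {}\<rbrakk> \<Longrightarrow> \<exists>u. is_lub_in G P A u"

text \<open>\<open>bounded_pair G P p q\<close> says that \<open>p \<or> q < \<infinity>\<close>; only then is \<open>join G P p q\<close> meaningful.\<close>

definition bounded_pair :: "('g, 'm) monoid_scheme \<Rightarrow> 'g set \<Rightarrow> 'g \<Rightarrow> 'g \<Rightarrow> bool" where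
  "bounded_pair G P p q \<longleftrightarrow> upper_bounds_in G P {p, q} \<noteq> {}"

definition join :: "('g, 'm) monoid_scheme \<Rightarrow> 'g set \<Rightarrow> 'g \<Rightarrow> 'g \<Rightarrow> 'g" where
  "join G P p q = (THE u. is_lub_in G P {p, q} u)"


section \<open>Product systems of graphs\<close>

text \<open>Graphs are directed graphs in the sense of \<open>pre_digraph\<close>, with \<open>tail\<close> the source map and
  \<open>head\<close> the range map.\<close>

definition fibre_product ::
    "('v, 'e) pre_digraph \<Rightarrow> ('v, 'f) pre_digraph \<Rightarrow> ('v, 'e \<times> 'f) pre_digraph" where
  "fibre_product E F =
    \<lparr>verts = verts E,
     arcs = {(l, m). l \<in> arcs E \<and> m \<in> arcs F \<and> head E l = tail F m},
     tail = (\<lambda>(l, m). tail E l),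
     head = (\<lambda>(l, m). head F m)\<rparr>"

text \<open>Vertices and edges have the same type because the graph over the identity has the vertices
  themselves as its edges. The common vertex set is \<open>verts (E \<one>)\<close>.\<close>

locale product_system_of_graphs = monoid G + submonoid P G
  for G :: "('g, 'm) monoid_scheme" (structure) and P :: "'g set" +
  fixes E :: "'g \<Rightarrow> ('a, 'a) pre_digraph"
    and \<phi> :: "'g \<Rightarrow> 'g \<Rightarrow> 'a \<times> 'a \<Rightarrow> 'a"
  assumes countable_P: "countable P"
    and graph: "p \<in> P \<Longrightarrow> wf_digraph (E p)"
    and countable_verts: "p \<in> P \<Longrightarrow> countable (verts (E p))"
    and countable_arcs: "p \<in> P \<Longrightarrow> countable (arcs (E p))"
    and common_verts: "p \<in> P \<Longrightarrow> verts (E p) = verts (E \<one>)"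
    and disjoint_arcs: "\<lbrakk>p \<in> P; q \<in> P; p \<noteq> q\<rbrakk> \<Longrightarrow> arcs (E p) \<inter> arcs (E q) = {}"
    and iso_bij: "\<lbrakk>p \<in> P; q \<in> P\<rbrakk> \<Longrightarrow>
      bij_betw (\<phi> p q) (arcs (fibre_product (E p) (E q))) (arcs (E (p \<otimes> q)))"
    and iso_tail: "\<lbrakk>p \<in> P; q \<in> P; a \<in> arcs (fibre_product (E p) (E q))\<rbrakk> \<Longrightarrow>
      tail (E (p \<otimes> q)) (\<phi> p q a) = tail (fibre_product (E p) (E q)) a"
    and iso_head: "\<lbrakk>p \<in> P; q \<in> P; a \<in> arcs (fibre_product (E p) (E q))\<rbrakk> \<Longrightarrow>
      head (E (p \<otimes> q)) (\<phi> p q a) = head (fibre_product (E p) (E q)) a"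
    and iso_assoc: "\<lbrakk>p \<in> P; q \<in> P; t \<in> P; l \<in> arcs (E p); m \<in> arcs (E q); n \<in> arcs (E t);
        head (E p) l = tail (E q) m; head (E q) m = tail (E t) n\<rbrakk> \<Longrightarrow>
      \<phi> (p \<otimes> q) t (\<phi> p q (l, m), n) = \<phi> p (q \<otimes> t) (l, \<phi> q t (m, n))"
    and arcs_one: "arcs (E \<one>) = verts (E \<one>)"
    and tail_one: "v \<in> verts (E \<one>) \<Longrightarrow> tail (E \<one>) v = v"
    and head_one: "v \<in> verts (E \<one>) \<Longrightarrow> head (E \<one>) v = v"

definition all_arcs :: "'g set \<Rightarrow> ('g \<Rightarrow> ('a, 'a) pre_digraph) \<Rightarrow> 'a set" where
  "all_arcs P E = (\<Union>p\<in>P. arcs (E p))"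

definition degree :: "'g set \<Rightarrow> ('g \<Rightarrow> ('a, 'a) pre_digraph) \<Rightarrow> 'a \<Rightarrow> 'g" where
  "degree P E l = (THE p. p \<in> P \<and> l \<in> arcs (E p))"

definition factorise ::
    "('g \<Rightarrow> ('a, 'a) pre_digraph) \<Rightarrow> ('g \<Rightarrow> 'g \<Rightarrow> 'a \<times> 'a \<Rightarrow> 'a) \<Rightarrow> 'g \<Rightarrow> 'g \<Rightarrow> 'a \<Rightarrow> 'a \<times> 'a" where
  "factorise E \<phi> p q c = the_inv_into (arcs (fibre_product (E p) (E q))) (\<phi> p q) c"

text \<open>\<open>initial_segment G P E \<phi> p c\<close> is the edge written \<open>\<gamma>(e,p)\<close> for \<open>\<gamma> = c\<close>, where \<open>p \<le> d(\<gamma>)\<close>.\<close>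

definition initial_segment ::
    "('g, 'm) monoid_scheme \<Rightarrow> 'g set \<Rightarrow> ('g \<Rightarrow> ('a, 'a) pre_digraph) \<Rightarrow>
     ('g \<Rightarrow> 'g \<Rightarrow> 'a \<times> 'a \<Rightarrow> 'a) \<Rightarrow> 'g \<Rightarrow> 'a \<Rightarrow> 'a" where
  "initial_segment G P E \<phi> p c = fst (factorise E \<phi> p (inv\<^bsub>G\<^esub> p \<otimes>\<^bsub>G\<^esub> degree P E c) c)"

definition MCE ::
    "('g, 'm) monoid_scheme \<Rightarrow> 'g set \<Rightarrow> ('g \<Rightarrow> ('a, 'a) pre_digraph) \<Rightarrow>
     ('g \<Rightarrow> 'g \<Rightarrow> 'a \<times> 'a \<Rightarrow> 'a) \<Rightarrow> 'a \<Rightarrow> 'a \<Rightarrow> 'a set" where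
  "MCE G P E \<phi> m n =
    {c \<in> all_arcs P E.
       bounded_pair G P (degree P E m) (degree P E n) \<and>
       degree P E c = join G P (degree P E m) (degree P E n) \<and>
       initial_segment G P E \<phi> (degree P E m) c = m \<and>
       initial_segment G P E \<phi> (degree P E n) c = n}"

definition finitely_aligned ::
    "('g, 'm) monoid_scheme \<Rightarrow> 'g set \<Rightarrow> ('g \<Rightarrow> ('a, 'a) pre_digraph) \<Rightarrow>
     ('g \<Rightarrow> 'g \<Rightarrow> 'a \<times> 'a \<Rightarrow> 'a) \<Rightarrow> bool" where
  "finitely_aligned G P E \<phi> \<longleftrightarrow>
    (\<forall>m \<in> all_arcs P E. \<forall>n \<in> all_arcs P E. finite (MCE G P E \<phi> m n))"


section \<open>Hilbert bimodules of functions and their operators\<close>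

text \<open>Functions on a subset \<open>V\<close> of a type are represented by functions on the whole type that are
  zero off \<open>V\<close>. In \<open>C0 V\<close> the set \<open>V\<close> is discrete, so its compact subsets are the finite ones.\<close>

definition C0 :: "'v set \<Rightarrow> ('v \<Rightarrow> complex) set" where
  "C0 V = {a. (\<forall>v. v \<notin> V \<longrightarrow> a v = 0) \<and> (\<forall>\<epsilon>>0. finite {v \<in> V. \<epsilon> \<le> cmod (a v)})}"

text \<open>The vectors of a module are functions \<open>'e \<Rightarrow> complex\<close> with the pointwise vector space
  structure; the coefficients are functions \<open>'v \<Rightarrow> complex\<close> with the supremum norm.\<close>

record ('e, 'v) fun_bimodule =
  coeffs :: "('v \<Rightarrow> complex) set"
  vectors :: "('e \<Rightarrow> complex) set"
  right_action :: "('e \<Rightarrow> complex) \<Rightarrow> ('v \<Rightarrow> complex) \<Rightarrow> ('e \<Rightarrow> complex)"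
  left_action :: "('v \<Rightarrow> complex) \<Rightarrow> ('e \<Rightarrow> complex) \<Rightarrow> ('e \<Rightarrow> complex)"
  inner_prod :: "('e \<Rightarrow> complex) \<Rightarrow> ('e \<Rightarrow> complex) \<Rightarrow> ('v \<Rightarrow> complex)"

definition module_norm :: "('e, 'v) fun_bimodule \<Rightarrow> ('e \<Rightarrow> complex) \<Rightarrow> real" where
  "module_norm Y x = sqrt (SUP v. cmod (inner_prod Y x x v))"

text \<open>Operators on \<open>Y\<close> are extensional functions (\<open>undefined\<close> off \<open>vectors Y\<close>), so that an
  operator is determined by its values on \<open>Y\<close>.\<close>

definition adjointable_ops ::
    "('e, 'v) fun_bimodule \<Rightarrow> (('e \<Rightarrow> complex) \<Rightarrow> ('e \<Rightarrow> complex)) set" where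
  "adjointable_ops Y =
    {T \<in> vectors Y \<rightarrow>\<^sub>E vectors Y.
       \<exists>T' \<in> vectors Y \<rightarrow>\<^sub>E vectors Y.
         \<forall>x \<in> vectors Y. \<forall>y \<in> vectors Y. inner_prod Y (T x) y = inner_prod Y x (T' y)}"

definition rank_one ::
    "('e, 'v) fun_bimodule \<Rightarrow> ('e \<Rightarrow> complex) \<Rightarrow> ('e \<Rightarrow> complex) \<Rightarrow> ('e \<Rightarrow> complex) \<Rightarrow> ('e \<Rightarrow> complex)"
  where "rank_one Y x y = (\<lambda>z \<in> vectors Y. right_action Y x (inner_prod Y y z))"

definition finite_rank_ops ::
    "('e, 'v) fun_bimodule \<Rightarrow> (('e \<Rightarrow> complex) \<Rightarrow> ('e \<Rightarrow> complex)) set" where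
  "finite_rank_ops Y =
    {(\<lambda>z \<in> vectors Y. \<lambda>l. \<Sum>i<n. c i * rank_one Y (x i) (y i) z l) | (n::nat) c x y.
       (\<forall>i<n. x i \<in> vectors Y \<and> y i \<in> vectors Y)}"

text \<open>The closure of the span in the operator norm: the inner inequality for all \<open>z\<close> says that the
  operator norm of \<open>T - F\<close> is at most \<open>\<epsilon>\<close>.\<close>

definition compact_ops ::
    "('e, 'v) fun_bimodule \<Rightarrow> (('e \<Rightarrow> complex) \<Rightarrow> ('e \<Rightarrow> complex)) set" where
  "compact_ops Y =
    {T \<in> adjointable_ops Y.
       \<forall>\<epsilon>>0. \<exists>F \<in> finite_rank_ops Y.
         \<forall>z \<in> vectors Y. module_norm Y (\<lambda>l. T z l - F z l) \<le> \<epsilon> * module_norm Y z}"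


section \<open>Compactly aligned product systems of bimodules\<close>

text \<open>A product system is given by its fibres \<open>X p\<close> and the multiplications
  \<open>M p q\<close> from \<open>X p \<times> X q\<close> to \<open>X (p \<otimes> q)\<close>. For \<open>p \<le> t\<close>, \<open>amplify G X M p t S\<close> is the operator
  \<open>S\<close> of \<open>X p\<close> transported to \<open>X t\<close>, written with lower index \<open>p\<close> and upper index \<open>t\<close>.\<close>

definition amplify ::
    "('g, 'm) monoid_scheme \<Rightarrow> ('g \<Rightarrow> ('e, 'v) fun_bimodule) \<Rightarrow>
     ('g \<Rightarrow> 'g \<Rightarrow> ('e \<Rightarrow> complex) \<Rightarrow> ('e \<Rightarrow> complex) \<Rightarrow> ('e \<Rightarrow> complex)) \<Rightarrow>
     'g \<Rightarrow> 'g \<Rightarrow> (('e \<Rightarrow> complex) \<Rightarrow> ('e \<Rightarrow> complex)) \<Rightarrow> (('e \<Rightarrow> complex) \<Rightarrow> ('e \<Rightarrow> complex))" where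
  "amplify G X M p t S =
    (let q = inv\<^bsub>G\<^esub> p \<otimes>\<^bsub>G\<^esub> t in
     THE R. R \<in> adjointable_ops (X t) \<and>
       (\<forall>x \<in> vectors (X p). \<forall>y \<in> vectors (X q). R (M p q x y) = M p q (S x) y))"

definition compactly_aligned ::
    "('g, 'm) monoid_scheme \<Rightarrow> 'g set \<Rightarrow> ('g \<Rightarrow> ('e, 'v) fun_bimodule) \<Rightarrow>
     ('g \<Rightarrow> 'g \<Rightarrow> ('e \<Rightarrow> complex) \<Rightarrow> ('e \<Rightarrow> complex) \<Rightarrow> ('e \<Rightarrow> complex)) \<Rightarrow> bool" where
  "compactly_aligned G P X M \<longleftrightarrow>
    (\<forall>p \<in> P. \<forall>q \<in> P. bounded_pair G P p q \<longrightarrow>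
      (let t = join G P p q in
       \<forall>S \<in> compact_ops (X p). \<forall>T \<in> compact_ops (X q).
         compose (vectors (X t)) (amplify G X M p t S) (amplify G X M q t T)
           \<in> compact_ops (X t)))"


section \<open>Cuntz--Krieger bimodules\<close>

definition CK_bimodule :: "('v, 'e) pre_digraph \<Rightarrow> ('e, 'v) fun_bimodule" where
  "CK_bimodule E =
    \<lparr>coeffs = C0 (verts E),
     vectors =
       {x. (\<forall>l. l \<notin> arcs E \<longrightarrow> x l = 0) \<and>
           (\<forall>v \<in> verts E. (\<lambda>l. (cmod (x l))\<^sup>2) summable_on {l \<in> arcs E. head E l = v}) \<and>
           (\<lambda>v. complex_of_real (\<Sum>\<^sub>\<infinity>l \<in> {l \<in> arcs E. head E l = v}. (cmod (x l))\<^sup>2))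
             \<in> C0 (verts E)},
     right_action = (\<lambda>x a l. x l * a (head E l)),
     left_action = (\<lambda>a x l. a (tail E l) * x l),
     inner_prod = (\<lambda>x y v. \<Sum>\<^sub>\<infinity>l \<in> {l \<in> arcs E. head E l = v}. cnj (x l) * y l)\<rparr>"

definition CK_mult ::
    "('g, 'm) monoid_scheme \<Rightarrow> ('g \<Rightarrow> ('a, 'a) pre_digraph) \<Rightarrow> ('g \<Rightarrow> 'g \<Rightarrow> 'a \<times> 'a \<Rightarrow> 'a) \<Rightarrow>
     'g \<Rightarrow> 'g \<Rightarrow> ('a \<Rightarrow> complex) \<Rightarrow> ('a \<Rightarrow> complex) \<Rightarrow> ('a \<Rightarrow> complex)" where
  "CK_mult G E \<phi> p q x y =
    (\<lambda>c. if c \<in> arcs (E (p \<otimes>\<^bsub>G\<^esub> q))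
         then (case factorise E \<phi> p q c of (l, m) \<Rightarrow> x l * y m) else 0)"

end

theory Submission
  imports Defs
begin

text \<open>A Cuntz--Krieger bimodule is a \<open>c\<^sub>0\<close>-sum of the Hilbert spaces \<open>\<ell>\<^sup>2\<close> of the fibres of the range map, and
  a compact operator is one that is nearly unchanged by cutting off all but finitely many
  coordinates, on either side. If \<open>S\<close> and \<open>T\<close> are compact on \<open>X\<^sub>p\<close> and \<open>X\<^sub>q\<close>, then up to a small error
  the product of their amplifications factors through the coordinates \<open>\<gamma>\<close> of degree \<open>p \<or> q\<close>
  with \<open>\<gamma>(e,p)\<close> and \<open>\<gamma>(e,q)\<close> in given finite sets. Finite alignment says that there are finitely
  many such \<open>\<gamma>\<close>, so the product is approximated by finite rank operators. Conversely, for the coordinate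
  projections onto \<open>\<mu>\<close> and \<open>\<nu>\<close> the product is the coordinate projection onto \<open>MCE(\<mu>,\<nu>)\<close>, which is
  compact only if that set is finite.\<close>

section \<open>Square-summable families\<close>

text \<open>All estimates are made on one fibre of the range map at a time and not in the module
  norm. This is possible because adjointability forces an operator to act on each fibre separately,
  and it pays off in the amplification: the slice of a vector of degree pq at an edge m of degree q
  sits in the single fibre of \<open>X p\<close> over the source of m, so a fibrewise bound for S is
  inherited by its amplification with the same constant. The descriptive definition of the amplified
  operator is matched with this slicewise formula. Uniqueness is not a density argument, since a
  competing operator is not given as continuous: an adjointable operator is determined by its matrix
  entries, and every coordinate vector of degree pq is a product of coordinate vectors. In the
  product of two amplifications the cuts are placed on the inside, after the operator coming from
  degree q and before the one coming from degree p. There both become cuts by sets of edges of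
  degree p \<or> q and can be intersected.\<close>

definition sqsum :: "'e set \<Rightarrow> ('e \<Rightarrow> complex) \<Rightarrow> bool" where
  "sqsum A f \<longleftrightarrow> (\<lambda>l. (cmod (f l))\<^sup>2) summable_on A"

definition l2n :: "'e set \<Rightarrow> ('e \<Rightarrow> complex) \<Rightarrow> real" where
  "l2n A f = sqrt (\<Sum>\<^sub>\<infinity>l\<in>A. (cmod (f l))\<^sup>2)"

lemma l2n_nonneg [simp]: "0 \<le> l2n A f"
  by (simp add: l2n_def infsum_nonneg)

lemma l2n_sq: "(l2n A f)\<^sup>2 = (\<Sum>\<^sub>\<infinity>l\<in>A. (cmod (f l))\<^sup>2)"
  by (simp add: l2n_def infsum_nonneg)

lemma l2n_empty [simp]: "l2n {} f = 0"
  by (simp add: l2n_def)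

lemma sqsum_cong: "(\<And>l. l \<in> A \<Longrightarrow> f l = g l) \<Longrightarrow> sqsum A f \<longleftrightarrow> sqsum A g"
  unfolding sqsum_def by (intro summable_on_cong) auto

lemma l2n_cong: "(\<And>l. l \<in> A \<Longrightarrow> f l = g l) \<Longrightarrow> l2n A f = l2n A g"
  unfolding l2n_def by (metis (mono_tags, lifting) infsum_cong)

lemma l2n_zero: "(\<And>l. l \<in> A \<Longrightarrow> f l = 0) \<Longrightarrow> l2n A f = 0"
  using l2n_cong[of A f "\<lambda>_. 0"] by (simp add: l2n_def)

lemma sqsum_zero: "(\<And>l. l \<in> A \<Longrightarrow> f l = 0) \<Longrightarrow> sqsum A f"
  using sqsum_cong[of A f "\<lambda>_. 0"] by (simp add: sqsum_def)

lemma L2_set_le_l2n: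
  assumes "sqsum A f" "finite F" "F \<subseteq> A"
  shows "L2_set (\<lambda>l. cmod (f l)) F \<le> l2n A f"
  unfolding L2_set_def l2n_def
  by (intro real_sqrt_le_mono finite_sum_le_infsum) (use assms in \<open>auto simp: sqsum_def\<close>)

text \<open>Finite partial sums control both summability and the norm, so the finite inequalities
  for \<open>L2_set\<close> pass to arbitrary index sets.\<close>

lemma sqsum_l2n_boundI:
  assumes "\<And>F. finite F \<Longrightarrow> F \<subseteq> A \<Longrightarrow> L2_set (\<lambda>l. cmod (f l)) F \<le> b" "0 \<le> b"
  shows "sqsum A f" "l2n A f \<le> b"
proof -
  have *: "(\<Sum>l\<in>F. (cmod (f l))\<^sup>2) \<le> b\<^sup>2" if "finite F" "F \<subseteq> A" for F
    using assms(1)[OF that] assms(2) unfolding L2_set_def by (metis sqrt_le_D)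
  show s: "sqsum A f"
    unfolding sqsum_def
    by (rule nonneg_bdd_above_summable_on) (auto intro!: bdd_aboveI2[where M = "b\<^sup>2"] *)
  have "(\<Sum>\<^sub>\<infinity>l\<in>A. (cmod (f l))\<^sup>2) \<le> b\<^sup>2"
    by (rule infsum_le_finite_sums) (use s * in \<open>auto simp: sqsum_def\<close>)
  then show "l2n A f \<le> b"
    unfolding l2n_def using assms(2) real_le_lsqrt by blast
qed

lemma l2n_mono:
  assumes "sqsum A g" "\<And>l. l \<in> A \<Longrightarrow> cmod (f l) \<le> cmod (g l)"
  shows "sqsum A f" "l2n A f \<le> l2n A g"
proof -
  have *: "L2_set (\<lambda>l. cmod (f l)) F \<le> l2n A g" if "finite F" "F \<subseteq> A" for F
  proof -
    have "L2_set (\<lambda>l. cmod (f l)) F \<le> L2_set (\<lambda>l. cmod (g l)) F"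
      using that assms(2) by (intro L2_set_mono) auto
    with L2_set_le_l2n[OF assms(1) that] show ?thesis by linarith
  qed
  show "sqsum A f" "l2n A f \<le> l2n A g"
    using sqsum_l2n_boundI[of A f "l2n A g"] * by auto
qed

section \<open>Minkowski and Cauchy-Schwarz inequalities, small tails\<close>

lemma l2n_triangle:
  assumes "sqsum A f" "sqsum A g"
  shows "sqsum A (\<lambda>l. f l + g l)" "l2n A (\<lambda>l. f l + g l) \<le> l2n A f + l2n A g"
proof -
  have *: "L2_set (\<lambda>l. cmod (f l + g l)) F \<le> l2n A f + l2n A g" if "finite F" "F \<subseteq> A" for F
  proof -
    have "L2_set (\<lambda>l. cmod (f l + g l)) F \<le> L2_set (\<lambda>l. cmod (f l) + cmod (g l)) F"
      by (intro L2_set_mono norm_triangle_ineq) auto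
    also have "\<dots> \<le> L2_set (\<lambda>l. cmod (f l)) F + L2_set (\<lambda>l. cmod (g l)) F"
      by (rule L2_set_triangle_ineq)
    finally show ?thesis
      using L2_set_le_l2n[OF assms(1) that] L2_set_le_l2n[OF assms(2) that] by linarith
  qed
  show "sqsum A (\<lambda>l. f l + g l)" "l2n A (\<lambda>l. f l + g l) \<le> l2n A f + l2n A g"
    using sqsum_l2n_boundI[of A "\<lambda>l. f l + g l" "l2n A f + l2n A g"] * by auto
qed

lemma l2n_cmult:
  shows "sqsum A f \<Longrightarrow> sqsum A (\<lambda>l. c * f l)" "l2n A (\<lambda>l. c * f l) = cmod c * l2n A f"
  by (auto simp: sqsum_def l2n_def norm_mult power_mult_distrib infsum_cmult_right'
      real_sqrt_mult intro: summable_on_cmult_right)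

lemma l2n_diff_triangle:
  assumes "sqsum A f" "sqsum A g"
  shows "sqsum A (\<lambda>l. f l - g l)" "l2n A (\<lambda>l. f l - g l) \<le> l2n A f + l2n A g"
  using l2n_triangle[OF assms(1) l2n_cmult(1)[OF assms(2), of "-1"]] l2n_cmult(2)[of A "-1" g]
  by auto

lemma l2_cauchy_schwarz:
  assumes "sqsum A f" "sqsum A g"
  shows "(\<lambda>l. cmod (cnj (f l) * g l)) summable_on A"
    and "cmod (\<Sum>\<^sub>\<infinity>l\<in>A. cnj (f l) * g l) \<le> l2n A f * l2n A g"
proof -
  have *: "(\<Sum>l\<in>F. cmod (cnj (f l) * g l)) \<le> l2n A f * l2n A g" if "finite F" "F \<subseteq> A" for F
  proof -
    have "(\<Sum>l\<in>F. cmod (cnj (f l) * g l))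
        \<le> L2_set (\<lambda>l. cmod (f l)) F * L2_set (\<lambda>l. cmod (g l)) F"
      using L2_set_mult_ineq[of "\<lambda>l. cmod (f l)" "\<lambda>l. cmod (g l)" F] by (simp add: norm_mult)
    also have "\<dots> \<le> l2n A f * l2n A g"
      using L2_set_le_l2n[OF assms(1) that] L2_set_le_l2n[OF assms(2) that]
      by (intro mult_mono) auto
    finally show ?thesis .
  qed
  show s: "(\<lambda>l. cmod (cnj (f l) * g l)) summable_on A"
    by (rule nonneg_bdd_above_summable_on)
      (auto intro!: bdd_aboveI2[where M = "l2n A f * l2n A g"] * simp del: complex_mod_cnj norm_mult)
  have "cmod (\<Sum>\<^sub>\<infinity>l\<in>A. cnj (f l) * g l) \<le> (\<Sum>\<^sub>\<infinity>l\<in>A. cmod (cnj (f l) * g l))"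
    by (rule norm_infsum_bound[OF s])
  also have "\<dots> \<le> l2n A f * l2n A g"
    by (rule infsum_le_finite_sums[OF s]) (rule *)
  finally show "cmod (\<Sum>\<^sub>\<infinity>l\<in>A. cnj (f l) * g l) \<le> l2n A f * l2n A g" .
qed

lemma infsum_inner_self:
  assumes "sqsum A f"
  shows "(\<Sum>\<^sub>\<infinity>l\<in>A. cnj (f l) * f l) = of_real ((l2n A f)\<^sup>2)"
proof -
  have "(\<Sum>\<^sub>\<infinity>l\<in>A. cnj (f l) * f l) = (\<Sum>\<^sub>\<infinity>l\<in>A. complex_of_real ((cmod (f l))\<^sup>2))"
    by (intro infsum_cong) (metis complex_norm_square mult.commute)
  also have "\<dots> = of_real (\<Sum>\<^sub>\<infinity>l\<in>A. (cmod (f l))\<^sup>2)"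
    by (rule infsum_bounded_linear_strong[OF _ bounded_linear_of_real])
      (use assms summable_on_bounded_linear[OF bounded_linear_of_real] in \<open>simp add: sqsum_def del: of_real_power\<close>)
  finally show ?thesis by (simp add: l2n_sq)
qed

text \<open>The bound holds for every superset of \<open>F\<close>, even an infinite one, so that
  finite sets chosen for several vectors can later be united.\<close>

lemma l2n_tail_small:
  assumes "sqsum A f" "\<epsilon> > 0"
  obtains F where "finite F" "F \<subseteq> A"
    "\<And>F'. F \<subseteq> F' \<Longrightarrow> l2n A (\<lambda>l. if l \<in> F' then 0 else f l) \<le> \<epsilon>"
proof -
  let ?g = "\<lambda>l. (cmod (f l))\<^sup>2"
  have s: "?g summable_on A" using assms by (simp add: sqsum_def)
  obtain F where F: "finite F" "F \<subseteq> A" "dist (sum ?g F) (infsum ?g A) \<le> \<epsilon>\<^sup>2"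
    using infsum_finite_approximation[OF s, of "\<epsilon>\<^sup>2"] assms(2) by auto
  show ?thesis
  proof (rule that[OF F(1,2)])
    fix F' assume FF': "F \<subseteq> F'"
    show "l2n A (\<lambda>l. if l \<in> F' then 0 else f l) \<le> \<epsilon>"
    proof (rule sqsum_l2n_boundI(2))
      fix K assume K: "finite K" "K \<subseteq> A"
      have "(\<Sum>l\<in>K. (cmod (if l \<in> F' then 0 else f l))\<^sup>2) = sum ?g (K - F')"
        using K by (intro sum.mono_neutral_cong_right) auto
      also have "\<dots> \<le> sum ?g (K - F)"
        using FF' K by (intro sum_mono2) auto
      \<comment> \<open>Together with \<open>F\<close> the part of \<open>K\<close> outside
        \<open>F\<close> is still a finite partial sum, so its mass is at most the total minus the
        sum over \<open>F\<close>.\<close>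
      also have "\<dots> = sum ?g (F \<union> (K - F)) - sum ?g F"
        using F K by (subst sum.union_disjoint) auto
      also have "sum ?g (F \<union> (K - F)) \<le> infsum ?g A"
        using F K by (intro finite_sum_le_infsum[OF s]) auto
      finally have "(\<Sum>l\<in>K. (cmod (if l \<in> F' then 0 else f l))\<^sup>2) \<le> \<epsilon>\<^sup>2"
        using F(3) by (simp add: dist_real_def)
      then show "L2_set (\<lambda>l. cmod (if l \<in> F' then 0 else f l)) K \<le> \<epsilon>"
        unfolding L2_set_def using assms(2) by (intro real_le_lsqrt) auto
    qed (use assms in auto)
  qed
qed

section \<open>The fibrewise norm of a Cuntz--Krieger bimodule\<close>

definition fibre :: "('v, 'e) pre_digraph \<Rightarrow> 'v \<Rightarrow> 'e set" where
  "fibre E v = {l \<in> arcs E. head E l = v}"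

abbreviation X :: "('v, 'e) pre_digraph \<Rightarrow> ('e \<Rightarrow> complex) set" where
  "X E \<equiv> vectors (CK_bimodule E)"

abbreviation fnorm :: "('v, 'e) pre_digraph \<Rightarrow> ('e \<Rightarrow> complex) \<Rightarrow> 'v \<Rightarrow> real" where
  "fnorm E x v \<equiv> l2n (fibre E v) x"

abbreviation ip :: "('v, 'e) pre_digraph \<Rightarrow> ('e \<Rightarrow> complex) \<Rightarrow> ('e \<Rightarrow> complex) \<Rightarrow> 'v \<Rightarrow> complex" where
  "ip E \<equiv> inner_prod (CK_bimodule E)"

definition \<delta> :: "'e \<Rightarrow> 'e \<Rightarrow> complex" where
  "\<delta> l = (\<lambda>k. if k = l then 1 else 0)"

lemma ip_eq: "ip E x y v = (\<Sum>\<^sub>\<infinity>l\<in>fibre E v. cnj (x l) * y l)"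
  by (simp add: CK_bimodule_def fibre_def)

lemma ip_cong:
  "(\<And>l. l \<in> fibre E v \<Longrightarrow> x l = x' l) \<Longrightarrow> (\<And>l. l \<in> fibre E v \<Longrightarrow> y l = y' l) \<Longrightarrow>
    ip E x y v = ip E x' y' v"
  unfolding ip_eq by (intro infsum_cong) auto

lemma infsum_sum:
  fixes f :: "'i \<Rightarrow> 'b \<Rightarrow> 'c::{topological_comm_monoid_add, t2_space}"
  assumes "finite I" "\<And>i. i \<in> I \<Longrightarrow> f i summable_on A"
  shows "(\<lambda>k. \<Sum>i\<in>I. f i k) summable_on A"
    and "(\<Sum>\<^sub>\<infinity>k\<in>A. \<Sum>i\<in>I. f i k) = (\<Sum>i\<in>I. infsum (f i) A)"
  using assms by (induction I rule: finite_induct) (auto simp: infsum_add summable_on_add)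

lemma cnj_ip: "cnj (ip E x y v) = ip E y x v"
  unfolding ip_eq by (simp flip: infsum_cnj add: mult.commute)

context
  fixes E :: "('v, 'e) pre_digraph"
  assumes wf: "wf_digraph E"
begin

lemma fibre_outside: "v \<notin> verts E \<Longrightarrow> fibre E v = {}"
  using wf by (auto simp: fibre_def wf_digraph_def)

text \<open>The vanishing condition of \<open>CK_bimodule\<close> concerns squared norms at
  vertices. Replacing \<epsilon> by its square passes to norms, and fibres outside
  \<open>verts E\<close> are empty, so both conditions may quantify over the whole type.\<close>

lemma X_iff:
  "x \<in> X E \<longleftrightarrow> (\<forall>l. l \<notin> arcs E \<longrightarrow> x l = 0) \<and> (\<forall>v. sqsum (fibre E v) x) \<and>
     (\<forall>\<epsilon>>0. finite {v. \<epsilon> \<le> fnorm E x v})"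
proof -
  have 1: "(\<forall>v\<in>verts E. (\<lambda>l. (cmod (x l))\<^sup>2) summable_on fibre E v) \<longleftrightarrow> (\<forall>v. sqsum (fibre E v) x)"
    unfolding sqsum_def by (metis fibre_outside summable_on_empty)
  have *: "{v \<in> verts E. \<epsilon> \<le> cmod (complex_of_real (\<Sum>\<^sub>\<infinity>l\<in>fibre E v. (cmod (x l))\<^sup>2))}
      = {v. sqrt \<epsilon> \<le> fnorm E x v}" if "\<epsilon> > 0" for \<epsilon>
  proof (intro Collect_cong)
    fix v
    have "cmod (complex_of_real (\<Sum>\<^sub>\<infinity>l\<in>fibre E v. (cmod (x l))\<^sup>2)) = (\<Sum>\<^sub>\<infinity>l\<in>fibre E v. (cmod (x l))\<^sup>2)"
      by (simp add: infsum_nonneg)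
    moreover have "v \<in> verts E" if "sqrt \<epsilon> \<le> fnorm E x v"
      using that \<open>\<epsilon> > 0\<close> fibre_outside[of v] by fastforce
    ultimately show "(v \<in> verts E \<and> \<epsilon> \<le> cmod (complex_of_real (\<Sum>\<^sub>\<infinity>l\<in>fibre E v. (cmod (x l))\<^sup>2)))
      \<longleftrightarrow> sqrt \<epsilon> \<le> fnorm E x v"
      by (auto simp: l2n_def)
  qed
  have 2: "(\<lambda>v. complex_of_real (\<Sum>\<^sub>\<infinity>l\<in>fibre E v. (cmod (x l))\<^sup>2)) \<in> C0 (verts E)
     \<longleftrightarrow> (\<forall>\<epsilon>>0. finite {v. sqrt \<epsilon> \<le> fnorm E x v})"
    unfolding C0_def using * by (auto simp: fibre_outside)
  have 3: "(\<forall>\<epsilon>>0. finite {v. sqrt \<epsilon> \<le> fnorm E x v}) \<longleftrightarrow> (\<forall>\<epsilon>>0. finite {v. \<epsilon> \<le> fnorm E x v})"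
  proof (intro iffI allI impI)
    fix \<epsilon> :: real
    assume "\<forall>\<epsilon>>0. finite {v. sqrt \<epsilon> \<le> fnorm E x v}" "\<epsilon> > 0"
    from this(1)[rule_format, of "\<epsilon>\<^sup>2"] this(2) show "finite {v. \<epsilon> \<le> fnorm E x v}" by simp
  qed auto
  show ?thesis
    using 1 2 3 by (simp add: CK_bimodule_def fibre_def)
qed

lemma X_zero_off: "x \<in> X E \<Longrightarrow> l \<notin> arcs E \<Longrightarrow> x l = 0"
  by (simp add: X_iff)

lemma X_sqsum [simp]: "x \<in> X E \<Longrightarrow> sqsum (fibre E v) x"
  by (simp add: X_iff)

text \<open>Two dominating vectors cover sums and differences; where one is enough, the zero vector
  fills the other place.\<close>

lemma X_domI:
  assumes "x \<in> X E" "y \<in> X E" "\<And>l. l \<notin> arcs E \<Longrightarrow> w l = 0" "\<And>v. sqsum (fibre E v) w"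
    and le: "\<And>v. fnorm E w v \<le> C * (fnorm E x v + fnorm E y v)"
  shows "w \<in> X E"
  unfolding X_iff
proof (intro conjI allI impI)
  fix \<epsilon> :: real assume "\<epsilon> > 0"
  \<comment> \<open>Each of the two dominating norms may use up half of \<epsilon>;
    \<open>\<bar>C\<bar> + 1\<close> is positive whatever the value of \<open>C\<close>.\<close>
  define e where "e = \<epsilon> / (2 * (\<bar>C\<bar> + 1))"
  have e: "e > 0" using \<open>\<epsilon> > 0\<close> by (auto simp: e_def)
  have "finite ({v. e \<le> fnorm E x v} \<union> {v. e \<le> fnorm E y v})"
    using assms(1,2) e by (simp add: X_iff)
  moreover have "{v. \<epsilon> \<le> fnorm E w v} \<subseteq> {v. e \<le> fnorm E x v} \<union> {v. e \<le> fnorm E y v}"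
  proof (rule subsetI, rule ccontr)
    fix v assume v: "v \<in> {v. \<epsilon> \<le> fnorm E w v}" "v \<notin> {v. e \<le> fnorm E x v} \<union> {v. e \<le> fnorm E y v}"
    have "fnorm E w v \<le> \<bar>C\<bar> * (fnorm E x v + fnorm E y v)"
      by (rule order_trans[OF le mult_right_mono]) auto
    also have "\<dots> \<le> (\<bar>C\<bar> + 1) * (fnorm E x v + fnorm E y v)"
      by (rule mult_right_mono) auto
    also have "\<dots> < (\<bar>C\<bar> + 1) * (e + e)"
      using v(2) by (intro mult_strict_left_mono) auto
    also have "\<dots> = \<epsilon>" unfolding e_def using abs_ge_zero[of C] by (simp add: divide_simps)
    finally show False using v(1) by auto
  qed
  ultimately show "finite {v. \<epsilon> \<le> fnorm E w v}" by (rule finite_subset[rotated])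
qed (use assms in auto)

text \<open>At most one fibre norm is nonzero, so the condition at infinity is automatic. Coordinate
  vectors and slices enter the module this way.\<close>

lemma X_single:
  assumes "\<And>l. l \<notin> fibre E v \<Longrightarrow> x l = 0" "sqsum (fibre E v) x"
  shows "x \<in> X E"
  unfolding X_iff
proof (intro conjI allI impI)
  have 0: "x l = 0" if "l \<in> fibre E w" "w \<noteq> v" for l w
    using that assms(1)[of l] by (auto simp: fibre_def)
  show "x l = 0" if "l \<notin> arcs E" for l
    using that assms(1)[of l] by (auto simp: fibre_def)
  show "sqsum (fibre E w) x" for w
  proof (cases "w = v")
    case False
    show ?thesis by (rule sqsum_zero) (rule 0[OF _ False])
  qed (simp add: assms(2))
  fix \<epsilon> :: real assume "\<epsilon> > 0"
  have "fnorm E x w = 0" if "w \<noteq> v" for w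
    by (rule l2n_zero) (rule 0[OF _ that])
  with \<open>\<epsilon> > 0\<close> have "{w. \<epsilon> \<le> fnorm E x w} \<subseteq> {v}"
    by force
  then show "finite {w. \<epsilon> \<le> fnorm E x w}" by (rule finite_subset) auto
qed

lemma X_zero [simp]: "(\<lambda>_. 0) \<in> X E"
  by (rule X_single) (auto intro: sqsum_zero)

text \<open>Scalar multiples, cuts to a set of edges and the right action by an inner product are
  all multiplications by a bounded function of the edge.\<close>

lemma X_mult:
  assumes "x \<in> X E" "\<And>l. cmod (f l) \<le> B"
  shows "(\<lambda>l. x l * f l) \<in> X E" "fnorm E (\<lambda>l. x l * f l) v \<le> B * fnorm E x v"
proof -
  have B: "0 \<le> B" using assms(2) norm_ge_zero order_trans by blast
  have dom: "cmod (x l * f l) \<le> cmod (of_real B * x l)" for l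
    using assms(2)[of l] B by (simp add: norm_mult mult.commute[of B] mult_left_mono)
  have sq: "sqsum (fibre E v) (\<lambda>l. of_real B * x l)" for v
    by (intro l2n_cmult(1) X_sqsum assms(1))
  have 1: "sqsum (fibre E v) (\<lambda>l. x l * f l)" for v
    using l2n_mono(1)[OF sq dom] .
  have 2: "fnorm E (\<lambda>l. x l * f l) v \<le> B * fnorm E x v" for v
    using l2n_mono(2)[OF sq dom, of v] B by (simp add: l2n_cmult(2))
  show "fnorm E (\<lambda>l. x l * f l) v \<le> B * fnorm E x v" by (rule 2)
  show "(\<lambda>l. x l * f l) \<in> X E"
  proof (rule X_domI[OF assms(1) X_zero])
    show "fnorm E (\<lambda>l. x l * f l) v \<le> B * (fnorm E x v + fnorm E (\<lambda>_. 0) v)" for v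
      using 2[of v] by (simp add: l2n_zero)
  qed (use 1 X_zero_off[OF assms(1)] in auto)
qed

lemma X_cmult: "x \<in> X E \<Longrightarrow> (\<lambda>l. c * x l) \<in> X E"
  using X_mult(1)[of x "\<lambda>_. c" "cmod c"] by (simp add: mult.commute)

lemma X_cut:
  assumes "x \<in> X E"
  shows "(\<lambda>l. if Q l then x l else 0) \<in> X E" "fnorm E (\<lambda>l. if Q l then x l else 0) v \<le> fnorm E x v"
proof -
  have "(\<lambda>l. if Q l then x l else 0) = (\<lambda>l. x l * (if Q l then 1 else 0))" by auto
  then show "(\<lambda>l. if Q l then x l else 0) \<in> X E" "fnorm E (\<lambda>l. if Q l then x l else 0) v \<le> fnorm E x v"
    using X_mult[OF assms, of "\<lambda>l. if Q l then 1 else 0" 1] by auto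
qed

lemma X_add: "x \<in> X E \<Longrightarrow> y \<in> X E \<Longrightarrow> (\<lambda>l. x l + y l) \<in> X E"
  by (rule X_domI[of x y _ 1]) (simp_all add: l2n_triangle X_zero_off)

lemma X_diff: "x \<in> X E \<Longrightarrow> y \<in> X E \<Longrightarrow> (\<lambda>l. x l - y l) \<in> X E"
  by (rule X_domI[of x y _ 1]) (simp_all add: l2n_diff_triangle X_zero_off)

lemma X_sum: "(\<And>i. i \<in> I \<Longrightarrow> x i \<in> X E) \<Longrightarrow> (\<lambda>l. \<Sum>i\<in>I. x i l) \<in> X E"
  by (induction I rule: infinite_finite_induct) (auto intro: X_add)

lemma fnorm_sum_le:
  "(\<And>i. i \<in> I \<Longrightarrow> x i \<in> X E) \<Longrightarrow> fnorm E (\<lambda>l. \<Sum>i\<in>I. x i l) v \<le> (\<Sum>i\<in>I. fnorm E (x i) v)"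
proof (induction I rule: infinite_finite_induct)
  case (insert i I)
  then have "fnorm E (\<lambda>l. x i l + (\<Sum>i\<in>I. x i l)) v \<le> fnorm E (x i) v + fnorm E (\<lambda>l. \<Sum>i\<in>I. x i l) v"
    by (intro l2n_triangle X_sqsum X_sum) auto
  then show ?case using insert by fastforce
qed (auto simp: l2n_zero)

lemma X_bounded:
  assumes "x \<in> X E"
  obtains B where "0 \<le> B" "\<And>v. fnorm E x v \<le> B"
proof -
  let ?S = "{v. 1 \<le> fnorm E x v}"
  have f: "finite ?S" using assms by (simp add: X_iff)
  \<comment> \<open>Only finitely many fibre norms reach 1; the summand 1 covers all the
    others.\<close>
  let ?B = "1 + (\<Sum>v\<in>?S. fnorm E x v)"
  have "fnorm E x v \<le> ?B" for v
  proof (cases "v \<in> ?S")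
    case True
    then have "fnorm E x v \<le> (\<Sum>v\<in>?S. fnorm E x v)"
      using f by (intro member_le_sum) auto
    then show ?thesis by linarith
  next
    case False
    moreover have "0 \<le> (\<Sum>v\<in>?S. fnorm E x v)" by (intro sum_nonneg) auto
    ultimately show ?thesis by auto
  qed
  moreover have "0 \<le> ?B" by (intro add_nonneg_nonneg sum_nonneg) auto
  ultimately show ?thesis using that by blast
qed

lemma ip_bound: "x \<in> X E \<Longrightarrow> y \<in> X E \<Longrightarrow> cmod (ip E x y v) \<le> fnorm E x v * fnorm E y v"
  unfolding ip_eq by (intro l2_cauchy_schwarz) auto

lemma ip_self: "x \<in> X E \<Longrightarrow> ip E x x v = of_real ((fnorm E x v)\<^sup>2)"
  unfolding ip_eq by (intro infsum_inner_self) auto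

section \<open>Coordinate vectors and rank one operators\<close>

lemma \<delta>_in_X:
  assumes "l \<in> arcs E"
  shows "\<delta> l \<in> X E"
proof (rule X_single[of "head E l"])
  have "finite {k \<in> fibre E (head E l). (cmod (\<delta> l k))\<^sup>2 \<noteq> 0}"
    by (rule finite_subset[of _ "{l}"]) (auto simp: \<delta>_def split: if_splits)
  then show "sqsum (fibre E (head E l)) (\<delta> l)"
    unfolding sqsum_def by (rule finite_nonzero_values_imp_summable_on)
qed (use assms in \<open>auto simp: \<delta>_def fibre_def\<close>)

lemma ip_\<delta>: "l \<in> arcs E \<Longrightarrow> ip E (\<delta> l) x v = (if v = head E l then x l else 0)"
proof -
  assume l: "l \<in> arcs E"
  have "ip E (\<delta> l) x v = (\<Sum>\<^sub>\<infinity>k\<in>fibre E v \<inter> {l}. x k)"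
    unfolding ip_eq by (intro infsum_cong_neutral) (auto simp: \<delta>_def)
  moreover have "fibre E v \<inter> {l} = (if v = head E l then {l} else {})"
    using l by (auto simp: fibre_def)
  ultimately show ?thesis by simp
qed

lemma ip_\<delta>_right: "l \<in> arcs E \<Longrightarrow> ip E x (\<delta> l) v = (if v = head E l then cnj (x l) else 0)"
  using ip_\<delta>[of l x v] cnj_ip[of E "\<delta> l" x v] by (simp split: if_splits)

lemma rank_one_eq: "z \<in> X E \<Longrightarrow> rank_one (CK_bimodule E) x y z = (\<lambda>l. x l * ip E y z (head E l))"
  by (simp add: rank_one_def) (simp add: CK_bimodule_def)

lemma rank_one_X:
  assumes "x \<in> X E" "y \<in> X E" "z \<in> X E"
  shows "(\<lambda>l. x l * ip E y z (head E l)) \<in> X E"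
    and "fnorm E (\<lambda>l. x l * ip E y z (head E l)) v = fnorm E x v * cmod (ip E y z v)"
proof -
  obtain B where B: "0 \<le> B" "\<And>v. fnorm E y v \<le> B" using X_bounded[OF assms(2)] by blast
  obtain C where C: "0 \<le> C" "\<And>v. fnorm E z v \<le> C" using X_bounded[OF assms(3)] by blast
  have "cmod (ip E y z v) \<le> B * C" for v
    by (rule order_trans[OF ip_bound mult_mono]) (use assms B C in auto)
  then show "(\<lambda>l. x l * ip E y z (head E l)) \<in> X E"
    by (intro X_mult(1) assms)
  \<comment> \<open>On the fibre over \<open>v\<close> the coefficient is the constant
    \<open>ip E y z v\<close>, which gives an equality and not just a bound.\<close>
  have "fnorm E (\<lambda>l. x l * ip E y z (head E l)) v = fnorm E (\<lambda>l. ip E y z v * x l) v"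
    by (rule l2n_cong) (auto simp: fibre_def)
  then show "fnorm E (\<lambda>l. x l * ip E y z (head E l)) v = fnorm E x v * cmod (ip E y z v)"
    by (simp add: l2n_cmult)
qed

section \<open>The module norm as a supremum of fibre norms\<close>

lemma module_norm_eq: "x \<in> X E \<Longrightarrow> module_norm (CK_bimodule E) x = sqrt (SUP v. (fnorm E x v)\<^sup>2)"
  by (simp add: module_norm_def ip_self norm_power)

lemma fnorm_le_module_norm:
  assumes "x \<in> X E"
  shows "fnorm E x v \<le> module_norm (CK_bimodule E) x"
proof -
  obtain B where B: "0 \<le> B" "\<And>v. fnorm E x v \<le> B" using X_bounded[OF assms] by blast
  have "(fnorm E x v)\<^sup>2 \<le> (SUP v. (fnorm E x v)\<^sup>2)"
    by (rule cSUP_upper) (use B in \<open>auto intro!: bdd_aboveI2[where M = "B\<^sup>2"] power_mono\<close>)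
  then show ?thesis
    unfolding module_norm_eq[OF assms] by (rule real_le_rsqrt)
qed

lemma module_norm_leI:
  assumes "x \<in> X E" "\<And>v. fnorm E x v \<le> B"
  shows "module_norm (CK_bimodule E) x \<le> B"
proof -
  have "0 \<le> B" using assms(2) l2n_nonneg order_trans by blast
  moreover have "(SUP v. (fnorm E x v)\<^sup>2) \<le> B\<^sup>2"
    by (rule cSUP_least) (use assms in \<open>auto intro!: power_mono\<close>)
  ultimately show ?thesis
    unfolding module_norm_eq[OF assms(1)] by (rule real_le_lsqrt)
qed

section \<open>Linearity and locality of adjointable operators\<close>

text \<open>Only the values on the fibre over \<open>head E l\<close> enter, so this covers linearity over
  \<open>C0 (verts E)\<close> as well as over the complex numbers.\<close>

lemma adjointable_lin_at:
  assumes T: "T \<in> adjointable_ops (CK_bimodule E)"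
    and "finite I" "z \<in> X E" "\<And>i. i \<in> I \<Longrightarrow> w i \<in> X E" "l \<in> arcs E"
    and eq: "\<And>k. k \<in> fibre E (head E l) \<Longrightarrow> z k = (\<Sum>i\<in>I. c i * w i k)"
  shows "T z l = (\<Sum>i\<in>I. c i * T (w i) l)"
proof -
  let ?F = "fibre E (head E l)"
  obtain T' where T': "T' \<in> X E \<rightarrow>\<^sub>E X E"
    and adj: "\<And>x y. x \<in> X E \<Longrightarrow> y \<in> X E \<Longrightarrow> ip E (T x) y = ip E x (T' y)"
    using T unfolding adjointable_ops_def by blast
  have d: "\<delta> l \<in> X E" "T' (\<delta> l) \<in> X E" using \<delta>_in_X T' assms(5) by auto
  \<comment> \<open>\<open>T' (\<delta> l)\<close> is the conjugate of row \<open>l\<close> of the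
    matrix of \<open>T\<close>, so every coordinate of \<open>T x\<close> is an inner product over
    one fibre.\<close>
  have *: "T x l = ip E (T' (\<delta> l)) x (head E l)" if "x \<in> X E" for x
  proof -
    have "cnj (T x l) = ip E x (T' (\<delta> l)) (head E l)"
      using adj[OF that d(1)] ip_\<delta>_right[OF assms(5), of "T x" "head E l"] by simp
    then show ?thesis by (metis cnj_ip complex_cnj_cnj)
  qed
  have s: "(\<lambda>k. cnj (T' (\<delta> l) k) * w i k) summable_on ?F" if "i \<in> I" for i
    using l2_cauchy_schwarz(1)[of ?F "T' (\<delta> l)" "w i"] d assms(4)[OF that]
    by (metis X_sqsum abs_summable_summable)
  have "T z l = (\<Sum>\<^sub>\<infinity>k\<in>?F. \<Sum>i\<in>I. c i * (cnj (T' (\<delta> l) k) * w i k))"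
    unfolding *[OF assms(3)] ip_eq
  proof (rule infsum_cong)
    fix k assume "k \<in> ?F"
    then show "cnj (T' (\<delta> l) k) * z k = (\<Sum>i\<in>I. c i * (cnj (T' (\<delta> l) k) * w i k))"
      by (subst eq) (simp_all add: sum_distrib_left mult.left_commute)
  qed
  also have "\<dots> = (\<Sum>i\<in>I. \<Sum>\<^sub>\<infinity>k\<in>?F. c i * (cnj (T' (\<delta> l) k) * w i k))"
    by (rule infsum_sum(2)[OF assms(2)]) (rule summable_on_cmult_right[OF s])
  also have "\<dots> = (\<Sum>i\<in>I. c i * T (w i) l)"
  proof (rule sum.cong[OF refl])
    fix i assume i: "i \<in> I"
    show "(\<Sum>\<^sub>\<infinity>k\<in>?F. c i * (cnj (T' (\<delta> l) k) * w i k)) = c i * T (w i) l"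
      unfolding *[OF assms(4)[OF i]] ip_eq by (rule infsum_cmult_right) (rule s[OF i])
  qed
  finally show ?thesis .
qed

lemma adjointable_local:
  assumes "T \<in> adjointable_ops (CK_bimodule E)" "z \<in> X E" "w \<in> X E" "l \<in> arcs E"
    and "\<And>k. k \<in> fibre E (head E l) \<Longrightarrow> z k = w k"
  shows "T z l = T w l"
  using adjointable_lin_at[OF assms(1), of "{()}" z "\<lambda>_. w" l "\<lambda>_. 1"] assms by simp

lemma adjointable_X: "T \<in> adjointable_ops (CK_bimodule E) \<Longrightarrow> x \<in> X E \<Longrightarrow> T x \<in> X E"
  unfolding adjointable_ops_def by auto

lemma adjointable_ext:
  assumes "T \<in> adjointable_ops (CK_bimodule E)" "S \<in> adjointable_ops (CK_bimodule E)"
    and "\<And>x l. x \<in> X E \<Longrightarrow> l \<in> arcs E \<Longrightarrow> T x l = S x l"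
  shows "T = S"
proof (rule extensionalityI[of _ "X E"])
  show "T \<in> extensional (X E)" "S \<in> extensional (X E)"
    using assms unfolding adjointable_ops_def by (auto simp: PiE_def)
  show "T x = S x" if "x \<in> X E" for x
  proof
    show "T x l = S x l" for l
      using assms(3)[OF that, of l] X_zero_off adjointable_X assms that by (cases "l \<in> arcs E") metis+
  qed
qed

end

section \<open>Compact operators\<close>

lemma real_div_small:
  fixes \<epsilon> b :: real
  assumes "\<epsilon> > 0" "b \<ge> 0"
  obtains \<eta> where "\<eta> > 0" "b * \<eta> \<le> \<epsilon>"
proof
  \<comment> \<open>Dividing by \<open>b + 1\<close> keeps the choice valid when \<open>b\<close> is
    zero.\<close>
  show "\<epsilon> / (b + 1) > 0" using assms by simp
  show "b * (\<epsilon> / (b + 1)) \<le> \<epsilon>" using assms by (simp add: divide_simps mult.commute)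
qed

definition proj :: "('v, 'e) pre_digraph \<Rightarrow> 'e set \<Rightarrow> ('e \<Rightarrow> complex) \<Rightarrow> 'e \<Rightarrow> complex" where
  "proj E D = (\<lambda>z \<in> X E. \<lambda>l. if l \<in> D then z l else 0)"

context
  fixes E :: "('v, 'e) pre_digraph"
  assumes wf: "wf_digraph E"
begin

text \<open>The module norm is a supremum over fibres, so an operator that acts on each fibre separately
  satisfies its norm bound on every single fibre.\<close>

lemma fibrewise_bound:
  assumes D: "\<And>z. z \<in> X E \<Longrightarrow> D z \<in> X E"
    and loc: "\<And>z w v l. z \<in> X E \<Longrightarrow> w \<in> X E \<Longrightarrow> (\<And>k. k \<in> fibre E v \<Longrightarrow> z k = w k) \<Longrightarrow>
      l \<in> fibre E v \<Longrightarrow> D z l = D w l"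
    and bd: "\<And>z. z \<in> X E \<Longrightarrow>
      module_norm (CK_bimodule E) (D z) \<le> C * module_norm (CK_bimodule E) z"
    and "0 \<le> C" "z \<in> X E"
  shows "fnorm E (D z) v \<le> C * fnorm E z v"
proof -
  \<comment> \<open>Dropping the rest of \<open>z\<close> does not change \<open>D z\<close> over
    \<open>v\<close>, and afterwards only one fibre contributes to the module norm.\<close>
  define z' where "z' = (\<lambda>l. if l \<in> fibre E v then z l else 0)"
  have z': "z' \<in> X E"
    unfolding z'_def by (rule X_cut(1)[OF wf assms(5)])
  have le: "fnorm E z' w \<le> fnorm E z v" for w
  proof (cases "w = v")
    case True
    have "fnorm E z' v = fnorm E z v"
      by (rule l2n_cong) (simp add: z'_def)
    then show ?thesis using True by simp
  next
    case False
    then have "fnorm E z' w = 0"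
      by (intro l2n_zero) (simp add: z'_def fibre_def)
    then show ?thesis by simp
  qed
  have "fnorm E (D z) v = fnorm E (D z') v"
    by (rule l2n_cong, rule loc[OF assms(5) z']) (auto simp: z'_def)
  also have "\<dots> \<le> module_norm (CK_bimodule E) (D z')"
    by (rule fnorm_le_module_norm[OF wf D[OF z']])
  also have "\<dots> \<le> C * module_norm (CK_bimodule E) z'"
    by (rule bd[OF z'])
  also have "\<dots> \<le> C * fnorm E z v"
    by (intro mult_left_mono module_norm_leI[OF wf z' le] assms(4))
  finally show ?thesis .
qed

section \<open>Finite rank approximation and tails of compact operators\<close>

lemma finite_rank_X:
  assumes "\<And>i. i \<in> I \<Longrightarrow> x i \<in> X E" "\<And>i. i \<in> I \<Longrightarrow> y i \<in> X E" "z \<in> X E"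
  shows "(\<lambda>l. \<Sum>i\<in>I. x i l * ip E (y i) z (head E l)) \<in> X E"
    and "fnorm E (\<lambda>l. \<Sum>i\<in>I. x i l * ip E (y i) z (head E l)) v
      \<le> (\<Sum>i\<in>I. fnorm E (x i) v * fnorm E (y i) v * fnorm E z v)"
proof -
  have *: "(\<lambda>l. x i l * ip E (y i) z (head E l)) \<in> X E"
    "fnorm E (\<lambda>l. x i l * ip E (y i) z (head E l)) v \<le> fnorm E (x i) v * fnorm E (y i) v * fnorm E z v"
    if "i \<in> I" for i
    using rank_one_X[OF wf assms(1)[OF that] assms(2)[OF that] assms(3)]
      mult_left_mono[OF ip_bound[OF wf assms(2)[OF that] assms(3), of v], of "fnorm E (x i) v"]
    by (simp_all add: mult.assoc)
  show "(\<lambda>l. \<Sum>i\<in>I. x i l * ip E (y i) z (head E l)) \<in> X E"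
    by (intro X_sum[OF wf] *)
  have "fnorm E (\<lambda>l. \<Sum>i\<in>I. x i l * ip E (y i) z (head E l)) v
      \<le> (\<Sum>i\<in>I. fnorm E (\<lambda>l. x i l * ip E (y i) z (head E l)) v)"
    by (intro fnorm_sum_le[OF wf] *)
  also have "\<dots> \<le> (\<Sum>i\<in>I. fnorm E (x i) v * fnorm E (y i) v * fnorm E z v)"
    by (intro sum_mono *)
  finally show "fnorm E (\<lambda>l. \<Sum>i\<in>I. x i l * ip E (y i) z (head E l)) v
      \<le> (\<Sum>i\<in>I. fnorm E (x i) v * fnorm E (y i) v * fnorm E z v)" .
qed

lemma compact_approx:
  assumes T: "T \<in> compact_ops (CK_bimodule E)" and "\<epsilon> > 0"
  shows "\<exists>(n::nat) x y. (\<forall>i<n. x i \<in> X E \<and> y i \<in> X E) \<and> (\<forall>z\<in>X E. \<forall>v.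
    fnorm E (\<lambda>l. T z l - (\<Sum>i<n. x i l * ip E (y i) z (head E l))) v \<le> \<epsilon> * fnorm E z v)"
proof -
  have adj: "T \<in> adjointable_ops (CK_bimodule E)" using T by (simp add: compact_ops_def)
  obtain F where F: "F \<in> finite_rank_ops (CK_bimodule E)"
    and bd: "\<And>z. z \<in> X E \<Longrightarrow>
      module_norm (CK_bimodule E) (\<lambda>l. T z l - F z l) \<le> \<epsilon> * module_norm (CK_bimodule E) z"
    using T \<open>\<epsilon> > 0\<close> unfolding compact_ops_def by blast
  obtain n :: nat and c x y where
    F_eq: "F = (\<lambda>z \<in> X E. \<lambda>l. \<Sum>i<n. c i * rank_one (CK_bimodule E) (x i) (y i) z l)"
    and xy: "\<And>i. i < n \<Longrightarrow> x i \<in> X E" "\<And>i. i < n \<Longrightarrow> y i \<in> X E"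
    using F unfolding finite_rank_ops_def by blast
  define x' where "x' i = (\<lambda>l. c i * x i l)" for i
  have x': "x' i \<in> X E" if "i < n" for i
    unfolding x'_def by (rule X_cmult[OF wf xy(1)[OF that]])
  have Fz: "F z = (\<lambda>l. \<Sum>i<n. x' i l * ip E (y i) z (head E l))" if "z \<in> X E" for z
    using that by (simp add: F_eq rank_one_eq[OF wf] x'_def mult.assoc)
  have FX: "F z \<in> X E" if "z \<in> X E" for z
    unfolding Fz[OF that] by (intro finite_rank_X x' xy that) auto
  show ?thesis
  proof (rule exI[of _ n], rule exI[of _ x'], rule exI[of _ y], rule conjI)
    show "\<forall>i<n. x' i \<in> X E \<and> y i \<in> X E" using x' xy(2) by blast
    show "\<forall>z\<in>X E. \<forall>v.
      fnorm E (\<lambda>l. T z l - (\<Sum>i<n. x' i l * ip E (y i) z (head E l))) v \<le> \<epsilon> * fnorm E z v"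
    proof (intro ballI allI)
      fix z v assume z: "z \<in> X E"
      \<comment> \<open>The operator \<open>T\<close> and the rank one operators all act on each
        fibre separately. Hence so does the error, and its bound in the module norm can be
        localised.\<close>
      have "fnorm E ((\<lambda>z l. T z l - F z l) z) v \<le> \<epsilon> * fnorm E z v"
      proof (rule fibrewise_bound)
        show "(\<lambda>l. T z l - F z l) \<in> X E" if "z \<in> X E" for z
          by (intro X_diff[OF wf] FX adjointable_X[OF wf adj] that)
        fix z w v l assume zw: "z \<in> X E" "w \<in> X E" "\<And>k. k \<in> fibre E v \<Longrightarrow> z k = w k" "l \<in> fibre E v"
        have l: "l \<in> arcs E" "head E l = v" using zw(4) by (auto simp: fibre_def)
        have "ip E (y i) z v = ip E (y i) w v" for i
          by (rule ip_cong) (use zw(3) in auto)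
        moreover have "T z l = T w l"
          by (rule adjointable_local[OF wf adj zw(1,2) l(1)]) (use zw(3) l in auto)
        ultimately show "T z l - F z l = T w l - F w l"
          by (simp add: Fz zw(1,2) l(2))
      qed (use bd z \<open>\<epsilon> > 0\<close> in auto)
      then show "fnorm E (\<lambda>l. T z l - (\<Sum>i<n. x' i l * ip E (y i) z (head E l))) v \<le> \<epsilon> * fnorm E z v"
        by (simp add: Fz z)
    qed
  qed
qed

lemma X_tail_small:
  assumes "x \<in> X E" "\<epsilon> > 0"
  shows "\<exists>F. finite F \<and> F \<subseteq> arcs E \<and>
    (\<forall>F' v. F \<subseteq> F' \<longrightarrow> fnorm E (\<lambda>l. if l \<in> F' then 0 else x l) v \<le> \<epsilon>)"
proof -
  \<comment> \<open>Away from these finitely many vertices the whole vector already has norm below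
    \<epsilon>, so nothing has to be kept there.\<close>
  let ?S = "{v. \<epsilon> \<le> fnorm E x v}"
  have S: "finite ?S" using assms by (simp add: X_iff[OF wf])
  have "\<exists>F. finite F \<and> F \<subseteq> fibre E v \<and>
      (\<forall>F'. F \<subseteq> F' \<longrightarrow> fnorm E (\<lambda>l. if l \<in> F' then 0 else x l) v \<le> \<epsilon>)" for v
    by (rule l2n_tail_small[OF X_sqsum[OF wf assms(1)] assms(2), of v]) blast
  then have "\<exists>K. \<forall>v. finite (K v) \<and> K v \<subseteq> fibre E v \<and>
      (\<forall>F'. K v \<subseteq> F' \<longrightarrow> fnorm E (\<lambda>l. if l \<in> F' then 0 else x l) v \<le> \<epsilon>)"
    by (intro choice allI)
  then obtain K where K: "\<And>v. finite (K v)" "\<And>v. K v \<subseteq> fibre E v"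
      "\<And>v F'. K v \<subseteq> F' \<Longrightarrow> fnorm E (\<lambda>l. if l \<in> F' then 0 else x l) v \<le> \<epsilon>"
    by blast
  have "fnorm E (\<lambda>l. if l \<in> F' then 0 else x l) v \<le> \<epsilon>" if F': "(\<Union>v\<in>?S. K v) \<subseteq> F'" for F' v
  proof (cases "v \<in> ?S")
    case True
    then show ?thesis using K(3) F' by blast
  next
    case False
    moreover have "fnorm E (\<lambda>l. if l \<in> F' then 0 else x l) v \<le> fnorm E x v"
      by (rule l2n_mono(2)) (auto simp: X_sqsum[OF wf assms(1)])
    ultimately show ?thesis by simp
  qed
  moreover have "finite (\<Union>v\<in>?S. K v)" "(\<Union>v\<in>?S. K v) \<subseteq> arcs E"
    using S K(1,2) by (auto simp: fibre_def)
  ultimately show ?thesis by blast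
qed

lemma X_tails_small:
  assumes "finite I" "\<forall>i\<in>I. x i \<in> X E" "\<epsilon> > 0"
  shows "\<exists>F. finite F \<and> F \<subseteq> arcs E \<and>
    (\<forall>F' v. \<forall>i\<in>I. F \<subseteq> F' \<longrightarrow> fnorm E (\<lambda>l. if l \<in> F' then 0 else x i l) v \<le> \<epsilon>)"
proof -
  have "\<forall>i\<in>I. \<exists>F. finite F \<and> F \<subseteq> arcs E \<and>
    (\<forall>F' v. F \<subseteq> F' \<longrightarrow> fnorm E (\<lambda>l. if l \<in> F' then 0 else x i l) v \<le> \<epsilon>)"
    by (rule ballI) (rule X_tail_small[OF bspec[OF assms(2)] assms(3)])
  from bchoice[OF this] obtain K where "\<forall>i\<in>I. finite (K i) \<and> K i \<subseteq> arcs E \<and>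
    (\<forall>F' v. K i \<subseteq> F' \<longrightarrow> fnorm E (\<lambda>l. if l \<in> F' then 0 else x i l) v \<le> \<epsilon>)" ..
  note K = bspec[OF this]
  show ?thesis
  proof (intro exI[of _ "\<Union>i\<in>I. K i"] conjI allI ballI impI)
    show "finite (\<Union>i\<in>I. K i)" by (rule finite_UN_I[OF assms(1)]) (rule K[THEN conjunct1])
    show "(\<Union>i\<in>I. K i) \<subseteq> arcs E" by (rule UN_least) (rule K[THEN conjunct2, THEN conjunct1])
    fix F' v i assume i: "i \<in> I" and "(\<Union>i\<in>I. K i) \<subseteq> F'"
    then have "K i \<subseteq> F'" by blast
    then show "fnorm E (\<lambda>l. if l \<in> F' then 0 else x i l) v \<le> \<epsilon>"
      by (rule K[OF i, THEN conjunct2, THEN conjunct2, rule_format])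
  qed
qed

lemma X_uniformly_bounded:
  assumes "finite I" "\<And>i. i \<in> I \<Longrightarrow> x i \<in> X E"
  shows "\<exists>B\<ge>0. \<forall>i\<in>I. \<forall>v. fnorm E (x i) v \<le> B"
proof -
  have "\<exists>b. \<forall>i\<in>I. 0 \<le> b i \<and> (\<forall>v. fnorm E (x i) v \<le> b i)"
  proof (intro bchoice ballI)
    fix i assume "i \<in> I"
    then show "\<exists>B. 0 \<le> B \<and> (\<forall>v. fnorm E (x i) v \<le> B)"
      by (rule X_bounded[OF wf assms(2)]) blast
  qed
  then obtain b where b: "\<And>i. i \<in> I \<Longrightarrow> 0 \<le> b i \<and> (\<forall>v. fnorm E (x i) v \<le> b i)"
    by blast
  have "fnorm E (x i) v \<le> sum b I" if "i \<in> I" for i v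
  proof -
    have "b i \<le> sum b I" by (rule member_le_sum[OF that]) (use b assms(1) in auto)
    moreover have "fnorm E (x i) v \<le> b i" using b[OF that] by blast
    ultimately show ?thesis by linarith
  qed
  moreover have "0 \<le> sum b I" using b by (intro sum_nonneg) auto
  ultimately show ?thesis by blast
qed

text \<open>The definition of \<open>adjointable_ops\<close> contains no norm bound. For a compact
  operator one is read off from any finite rank approximation, here with error 1, since a sum of
  \<open>n\<close> rank one operators is bounded by the sum of the products of the norms of its
  vectors.\<close>

lemma compact_bounded:
  assumes T: "T \<in> compact_ops (CK_bimodule E)"
  obtains C where "0 \<le> C" "\<And>z v. z \<in> X E \<Longrightarrow> fnorm E (T z) v \<le> C * fnorm E z v"
proof -
  have adj: "T \<in> adjointable_ops (CK_bimodule E)" using T by (simp add: compact_ops_def)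
  from compact_approx[OF T zero_less_one] obtain n :: nat and x y where
    nxy: "(\<forall>i<n. x i \<in> X E \<and> y i \<in> X E) \<and> (\<forall>z\<in>X E. \<forall>v.
      fnorm E (\<lambda>l. T z l - (\<Sum>i<n. x i l * ip E (y i) z (head E l))) v \<le> 1 * fnorm E z v)"
    by (elim exE)
  have xy: "x i \<in> X E" "y i \<in> X E" if "i < n" for i
    using conjunct1[OF nxy] that by simp_all
  have ap: "fnorm E (\<lambda>l. T z l - (\<Sum>i<n. x i l * ip E (y i) z (head E l))) v \<le> 1 * fnorm E z v"
    if "z \<in> X E" for z v
    by (rule conjunct2[OF nxy, rule_format, OF that])
  obtain A where A: "0 \<le> A" "\<And>i v. i < n \<Longrightarrow> fnorm E (x i) v \<le> A"
    using X_uniformly_bounded[of "{..<n}" x] xy(1) by auto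
  obtain B where B: "0 \<le> B" "\<And>i v. i < n \<Longrightarrow> fnorm E (y i) v \<le> B"
    using X_uniformly_bounded[of "{..<n}" y] xy(2) by auto
  have "fnorm E (T z) v \<le> (1 + n * (A * B)) * fnorm E z v" if z: "z \<in> X E" for z v
  proof -
    let ?F = "\<lambda>l. \<Sum>i<n. x i l * ip E (y i) z (head E l)"
    have FX: "?F \<in> X E" by (intro finite_rank_X xy z) auto
    have "fnorm E (T z) v = fnorm E (\<lambda>l. (T z l - ?F l) + ?F l) v" by simp
    also have "\<dots> \<le> fnorm E (\<lambda>l. T z l - ?F l) v + fnorm E ?F v"
      by (intro l2n_triangle X_sqsum[OF wf] X_diff[OF wf] FX adjointable_X[OF wf adj z])
    also have "fnorm E ?F v \<le> (\<Sum>i<n. fnorm E (x i) v * fnorm E (y i) v * fnorm E z v)"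
      by (intro finite_rank_X xy z) auto
    also have "\<dots> \<le> (\<Sum>i<n. A * B * fnorm E z v)"
      by (intro sum_mono mult_right_mono mult_mono A B) auto
    finally show ?thesis using ap[OF z, of v] by (simp add: algebra_simps)
  qed
  then show ?thesis using that[of "1 + n * (A * B)"] A(1) B(1) by simp
qed

text \<open>In a finite rank operator, cutting the output cuts the left vectors \<open>x i\<close>
  and cutting the input cuts the right vectors \<open>y i\<close>; finitely many vectors have a
  common finite set outside which all are small. The input bound is later applied to the left factor
  of the product, the output bound to the right factor.\<close>

lemma compact_tail_small:
  assumes T: "T \<in> compact_ops (CK_bimodule E)" and \<epsilon>: "\<epsilon> > 0"
  shows "\<exists>F. finite F \<and> F \<subseteq> arcs E \<and> (\<forall>z\<in>X E. \<forall>v.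
    fnorm E (T (\<lambda>l. if l \<in> F then 0 else z l)) v \<le> \<epsilon> * fnorm E z v \<and>
    fnorm E (\<lambda>l. if l \<in> F then 0 else T z l) v \<le> \<epsilon> * fnorm E z v)"
proof -
  have adj: "T \<in> adjointable_ops (CK_bimodule E)" using T by (simp add: compact_ops_def)
  from compact_approx[OF T half_gt_zero[OF \<epsilon>]] obtain n :: nat and x y where
    nxy: "(\<forall>i<n. x i \<in> X E \<and> y i \<in> X E) \<and> (\<forall>z\<in>X E. \<forall>v.
      fnorm E (\<lambda>l. T z l - (\<Sum>i<n. x i l * ip E (y i) z (head E l))) v \<le> \<epsilon> / 2 * fnorm E z v)"
    by (elim exE)
  have xy: "x i \<in> X E" "y i \<in> X E" if "i < n" for i
    using conjunct1[OF nxy] that by simp_all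
  have ap: "fnorm E (\<lambda>l. T z l - (\<Sum>i<n. x i l * ip E (y i) z (head E l))) v \<le> \<epsilon> / 2 * fnorm E z v"
    if "z \<in> X E" for z v
    by (rule conjunct2[OF nxy, rule_format, OF that])
  obtain A where A: "0 \<le> A" "\<And>i v. i < n \<Longrightarrow> fnorm E (x i) v \<le> A"
    using X_uniformly_bounded[of "{..<n}" x] xy(1) by auto
  obtain B where B: "0 \<le> B" "\<And>i v. i < n \<Longrightarrow> fnorm E (y i) v \<le> B"
    using X_uniformly_bounded[of "{..<n}" y] xy(2) by auto
  \<comment> \<open>Half of \<epsilon> goes to the approximation. In the other half, each of the
    \<open>n\<close> terms has one factor with a tail of norm at most \<eta> and one factor bounded
    by \<open>A\<close> or by \<open>B\<close>.\<close>
  obtain \<eta> where \<eta>: "\<eta> > 0" "(n * (A + B)) * \<eta> \<le> \<epsilon> / 2"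
    using real_div_small[OF half_gt_zero[OF \<epsilon>], of "n * (A + B)"] A(1) B(1) by auto
  have "\<forall>i\<in>{..<n}. x i \<in> X E" using xy(1) by simp
  from X_tails_small[of "{..<n}" x, OF finite_lessThan this \<eta>(1)]
  obtain F1 where F1_all: "finite F1 \<and> F1 \<subseteq> arcs E \<and>
      (\<forall>F' v. \<forall>i\<in>{..<n}. F1 \<subseteq> F' \<longrightarrow> fnorm E (\<lambda>l. if l \<in> F' then 0 else x i l) v \<le> \<eta>)"
    by (elim exE)
  have F1: "finite F1" "F1 \<subseteq> arcs E" using F1_all by blast+
  have "\<forall>i\<in>{..<n}. y i \<in> X E" using xy(2) by simp
  from X_tails_small[of "{..<n}" y, OF finite_lessThan this \<eta>(1)]
  obtain F2 where F2_all: "finite F2 \<and> F2 \<subseteq> arcs E \<and>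
      (\<forall>F' v. \<forall>i\<in>{..<n}. F2 \<subseteq> F' \<longrightarrow> fnorm E (\<lambda>l. if l \<in> F' then 0 else y i l) v \<le> \<eta>)"
    by (elim exE)
  have F2: "finite F2" "F2 \<subseteq> arcs E" using F2_all by blast+
  define F where "F = F1 \<union> F2"
  define cut where "cut z = (\<lambda>l. if l \<in> F then 0 else z l)" for z :: "'e \<Rightarrow> complex"
  have cut_X: "cut z \<in> X E" "fnorm E (cut z) v \<le> fnorm E z v" if "z \<in> X E" for z v
  proof -
    have *: "cut z = (\<lambda>l. if l \<notin> F then z l else 0)" by (rule ext) (simp add: cut_def)
    show "cut z \<in> X E" unfolding * by (rule X_cut(1)[OF wf that])
    show "fnorm E (cut z) v \<le> fnorm E z v" unfolding * by (rule X_cut(2)[OF wf that])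
  qed
  have cx: "fnorm E (cut (x i)) v \<le> \<eta>" if "i < n" for i v
    unfolding cut_def
    by (rule F1_all[THEN conjunct2, THEN conjunct2, rule_format]) (use that in \<open>auto simp: F_def\<close>)
  have cy: "fnorm E (cut (y i)) v \<le> \<eta>" if "i < n" for i v
    unfolding cut_def
    by (rule F2_all[THEN conjunct2, THEN conjunct2, rule_format]) (use that in \<open>auto simp: F_def\<close>)
  have nA: "n * (A * \<eta>) \<le> \<epsilon> / 2" and nB: "n * (\<eta> * B) \<le> \<epsilon> / 2"
  proof -
    have "n * (A * \<eta>) \<le> n * (A + B) * \<eta>" "n * (\<eta> * B) \<le> n * (A + B) * \<eta>"
      using A(1) B(1) \<eta>(1) by (simp_all add: algebra_simps)
    with \<eta>(2) show "n * (A * \<eta>) \<le> \<epsilon> / 2" "n * (\<eta> * B) \<le> \<epsilon> / 2" by linarith+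
  qed
  have 1: "fnorm E (T (cut z)) v \<le> \<epsilon> * fnorm E z v" if z: "z \<in> X E" for z v
  proof -
    let ?F = "\<lambda>l. \<Sum>i<n. x i l * ip E (y i) (cut z) (head E l)"
    \<comment> \<open>A coordinate where \<open>z\<close> has been cut to zero contributes nothing,
      so \<open>y i\<close> may be cut as well; this brings in its small tail.\<close>
    have ip_cut: "ip E (y i) (cut z) w = ip E (cut (y i)) (cut z) w" for i w
      unfolding ip_eq by (rule infsum_cong) (simp add: cut_def)
    have F_eq: "?F = (\<lambda>l. \<Sum>i<n. x i l * ip E (cut (y i)) (cut z) (head E l))"
      by (simp only: ip_cut)
    have FX: "?F \<in> X E" by (intro finite_rank_X xy cut_X z) auto
    have "fnorm E (T (cut z)) v = fnorm E (\<lambda>l. (T (cut z) l - ?F l) + ?F l) v" by simp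
    also have "\<dots> \<le> fnorm E (\<lambda>l. T (cut z) l - ?F l) v + fnorm E ?F v"
      by (intro l2n_triangle X_sqsum[OF wf] X_diff[OF wf] FX adjointable_X[OF wf adj] cut_X z)
    also have "fnorm E ?F v \<le> (\<Sum>i<n. fnorm E (x i) v * fnorm E (cut (y i)) v * fnorm E (cut z) v)"
      unfolding F_eq by (intro finite_rank_X cut_X xy z) auto
    also have "\<dots> \<le> (\<Sum>i<n. A * \<eta> * fnorm E z v)"
      using A \<eta>(1) by (intro sum_mono mult_mono cut_X z cy) auto
    also have "\<dots> = n * (A * \<eta>) * fnorm E z v" by simp
    also have "\<dots> \<le> \<epsilon> / 2 * fnorm E z v"
      by (rule mult_right_mono[OF nA]) simp
    also have "fnorm E (\<lambda>l. T (cut z) l - ?F l) v \<le> \<epsilon> / 2 * fnorm E z v"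
      by (rule order_trans[OF ap[OF cut_X(1)[OF z]] mult_left_mono[OF cut_X(2)[OF z]]]) (use \<epsilon> in simp)
    finally show ?thesis by simp
  qed
  have 2: "fnorm E (cut (T z)) v \<le> \<epsilon> * fnorm E z v" if z: "z \<in> X E" for z v
  proof -
    let ?F = "\<lambda>l. \<Sum>i<n. x i l * ip E (y i) z (head E l)"
    have FX: "?F \<in> X E" by (intro finite_rank_X xy z) auto
    have DX: "(\<lambda>l. T z l - ?F l) \<in> X E"
      by (intro X_diff[OF wf] FX adjointable_X[OF wf adj] z)
    have cF: "cut ?F = (\<lambda>l. \<Sum>i<n. cut (x i) l * ip E (y i) z (head E l))"
      by (auto simp: cut_def)
    have "fnorm E (cut (T z)) v = fnorm E (\<lambda>l. cut (\<lambda>l. T z l - ?F l) l + cut ?F l) v"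
      by (rule l2n_cong) (simp add: cut_def)
    also have "\<dots> \<le> fnorm E (cut (\<lambda>l. T z l - ?F l)) v + fnorm E (cut ?F) v"
      by (intro l2n_triangle X_sqsum[OF wf] cut_X FX DX)
    also have "fnorm E (cut ?F) v \<le> (\<Sum>i<n. fnorm E (cut (x i)) v * fnorm E (y i) v * fnorm E z v)"
      unfolding cF by (intro finite_rank_X cut_X xy z) auto
    also have "\<dots> \<le> (\<Sum>i<n. \<eta> * B * fnorm E z v)"
      using B \<eta>(1) by (intro sum_mono mult_mono z cx) auto
    also have "\<dots> = n * (\<eta> * B) * fnorm E z v" by simp
    also have "\<dots> \<le> \<epsilon> / 2 * fnorm E z v"
      by (rule mult_right_mono[OF nB]) simp
    also have "fnorm E (cut (\<lambda>l. T z l - ?F l)) v \<le> \<epsilon> / 2 * fnorm E z v"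
      by (rule order_trans[OF cut_X(2)[OF DX] ap[OF z]])
    finally show ?thesis by simp
  qed
  show ?thesis
  proof (rule exI[of _ F], intro conjI ballI allI)
    show "finite F" "F \<subseteq> arcs E" using F1 F2 by (auto simp: F_def)
  qed (use 1 2 in \<open>simp_all add: cut_def\<close>)
qed

text \<open>The index set may have any type, so that the approximating sums can run over edges.
  Scalars are absorbed into the vectors, and a bound on each fibre gives the bound for the
  supremum.\<close>

lemma compactI:
  assumes T: "T \<in> adjointable_ops (CK_bimodule E)"
    and ap: "\<And>\<epsilon>. \<epsilon> > 0 \<Longrightarrow> \<exists>J::'k set. \<exists>x y. finite J \<and> (\<forall>j\<in>J. x j \<in> X E \<and> y j \<in> X E) \<and>
      (\<forall>z\<in>X E. \<forall>v. fnorm E (\<lambda>l. T z l - (\<Sum>j\<in>J. x j l * ip E (y j) z (head E l))) v \<le> \<epsilon> * fnorm E z v)"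
  shows "T \<in> compact_ops (CK_bimodule E)"
  unfolding compact_ops_def
proof (intro CollectI conjI allI impI T)
  fix \<epsilon> :: real assume "\<epsilon> > 0"
  from ap[OF this] obtain J :: "'k set" and x y where J: "finite J"
    and xy: "\<And>j. j \<in> J \<Longrightarrow> x j \<in> X E" "\<And>j. j \<in> J \<Longrightarrow> y j \<in> X E"
    and le: "\<And>z v. z \<in> X E \<Longrightarrow>
      fnorm E (\<lambda>l. T z l - (\<Sum>j\<in>J. x j l * ip E (y j) z (head E l))) v \<le> \<epsilon> * fnorm E z v"
    by blast
  obtain h where h: "bij_betw h {..<card J} J"
    using ex_bij_betw_nat_finite[OF J] by (auto simp: atLeast0LessThan)
  let ?F = "\<lambda>z \<in> X E. \<lambda>l. \<Sum>i<card J. 1 * rank_one (CK_bimodule E) (x (h i)) (y (h i)) z l"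
  have Fz: "?F z = (\<lambda>l. \<Sum>j\<in>J. x j l * ip E (y j) z (head E l))" if "z \<in> X E" for z
    using that by (simp add: rank_one_eq[OF wf]
        sum.reindex_bij_betw[OF h, of "\<lambda>j. x j _ * ip E (y j) z (head E _)"])
  have "h i \<in> J" if "i < card J" for i
    using h that by (auto simp: bij_betw_def)
  then have "?F \<in> finite_rank_ops (CK_bimodule E)"
    unfolding finite_rank_ops_def using xy
    by (intro CollectI exI[of _ "card J"] exI[of _ "\<lambda>_. 1"] exI[of _ "\<lambda>i. x (h i)"]
        exI[of _ "\<lambda>i. y (h i)"]) auto
  moreover have "module_norm (CK_bimodule E) (\<lambda>l. T z l - ?F z l) \<le> \<epsilon> * module_norm (CK_bimodule E) z"
    if z: "z \<in> X E" for z
  proof (rule module_norm_leI[OF wf])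
    show "(\<lambda>l. T z l - ?F z l) \<in> X E"
      unfolding Fz[OF z] by (intro X_diff[OF wf] adjointable_X[OF wf T] z finite_rank_X xy)
    show "fnorm E (\<lambda>l. T z l - ?F z l) v \<le> \<epsilon> * module_norm (CK_bimodule E) z" for v
      unfolding Fz[OF z]
      by (rule order_trans[OF le[OF z] mult_left_mono[OF fnorm_le_module_norm[OF wf z]]])
        (use \<open>\<epsilon> > 0\<close> in simp)
  qed
  ultimately show "\<exists>F\<in>finite_rank_ops (CK_bimodule E). \<forall>z\<in>X E.
      module_norm (CK_bimodule E) (\<lambda>l. T z l - F z l) \<le> \<epsilon> * module_norm (CK_bimodule E) z"
    by blast
qed

section \<open>Coordinate projections\<close>

lemma proj_adjointable: "proj E D \<in> adjointable_ops (CK_bimodule E)"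
proof -
  have P: "proj E D \<in> X E \<rightarrow>\<^sub>E X E"
    unfolding proj_def by (intro restrict_PiE_iff[THEN iffD2] ballI X_cut(1)[OF wf])
  moreover have "ip E (proj E D x) y = ip E x (proj E D y)" if "x \<in> X E" "y \<in> X E" for x y
    unfolding ip_eq fun_eq_iff using that by (intro allI infsum_cong) (simp add: proj_def)
  ultimately show ?thesis unfolding adjointable_ops_def by blast
qed

lemma fnorm_\<delta>:
  assumes "l \<in> arcs E"
  shows "fnorm E (\<delta> l) (head E l) = 1"
proof -
  have "complex_of_real ((fnorm E (\<delta> l) (head E l))\<^sup>2) = 1"
    using ip_self[OF wf \<delta>_in_X[OF wf assms], of "head E l"] ip_\<delta>[OF wf assms, of "\<delta> l" "head E l"]
    by (simp add: \<delta>_def)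
  then have "(fnorm E (\<delta> l) (head E l))\<^sup>2 = 1" using of_real_eq_1_iff by blast
  then have "sqrt ((fnorm E (\<delta> l) (head E l))\<^sup>2) = sqrt 1" by (rule arg_cong)
  then show ?thesis by simp
qed

text \<open>The projection is the rank one operator of \<open>\<delta> l\<close> with itself, so one
  approximation is exact and serves for every \<epsilon>.\<close>

lemma proj_singleton_compact:
  assumes l: "l \<in> arcs E"
  shows "proj E {l} \<in> compact_ops (CK_bimodule E)"
proof (rule compactI[OF proj_adjointable])
  fix \<epsilon> :: real assume "\<epsilon> > 0"
  have "proj E {l} z k - (\<Sum>j\<in>{()}. \<delta> l k * ip E (\<delta> l) z (head E k)) = 0" if "z \<in> X E" for z k
    using that by (simp add: proj_def ip_\<delta>[OF wf l]) (simp add: \<delta>_def)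
  then show "\<exists>J::unit set. \<exists>x y. finite J \<and> (\<forall>j\<in>J. x j \<in> X E \<and> y j \<in> X E) \<and>
      (\<forall>z\<in>X E. \<forall>v. fnorm E (\<lambda>l'. proj E {l} z l' - (\<Sum>j\<in>J. x j l' * ip E (y j) z (head E l'))) v
        \<le> \<epsilon> * fnorm E z v)"
    using \<open>\<epsilon> > 0\<close> \<delta>_in_X[OF wf l]
    by (intro exI[of _ "{()}"] exI[of _ "\<lambda>_. \<delta> l"]) (simp add: l2n_zero)
qed

text \<open>A compact operator at least halves all vectors that vanish on a suitable finite set
  \<open>F\<close>, whereas the projection fixes the unit vector \<open>\<delta> l\<close> for each
  \<open>l\<close> in \<open>D\<close>. Hence \<open>D\<close> is contained in \<open>F\<close>; any
  factor below 1 would do in place of one half.\<close>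

lemma proj_compact_finite:
  assumes "D \<subseteq> arcs E" and c: "proj E D \<in> compact_ops (CK_bimodule E)"
  shows "finite D"
proof -
  from compact_tail_small[OF c, of "1/2"] obtain F where F: "finite F"
    "\<forall>z\<in>X E. \<forall>v. fnorm E (proj E D (\<lambda>l. if l \<in> F then 0 else z l)) v \<le> 1 / 2 * fnorm E z v"
    by auto
  have "l \<in> F" if l: "l \<in> D" for l
  proof (rule ccontr)
    assume "l \<notin> F"
    then have "(\<lambda>k. if k \<in> F then 0 else \<delta> l k) = \<delta> l" by (auto simp: \<delta>_def)
    moreover have la: "l \<in> arcs E" using l assms(1) by blast
    moreover have "proj E D (\<delta> l) = \<delta> l" using \<delta>_in_X[OF wf la] l by (auto simp: proj_def \<delta>_def)
    ultimately show False
      using F(2)[rule_format, OF \<delta>_in_X[OF wf la], of "head E l"] by (simp add: fnorm_\<delta>)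
  qed
  then have "D \<subseteq> F" by (rule subsetI)
  then show ?thesis using F(1) by (rule finite_subset)
qed

end

section \<open>Amplification along a composition of graphs\<close>

context
  fixes E :: "('v, 'e) pre_digraph"
  assumes wf: "wf_digraph E"
begin

section \<open>Matrix entries, adjoints and composition\<close>

lemma adjointable_add:
  assumes "T \<in> adjointable_ops (CK_bimodule E)" "x \<in> X E" "y \<in> X E"
  shows "T (\<lambda>l. x l + y l) = (\<lambda>l. T x l + T y l)"
proof
  fix l
  show "T (\<lambda>l. x l + y l) l = T x l + T y l"
  proof (cases "l \<in> arcs E")
    case True
    have "T (\<lambda>l. x l + y l) l = (\<Sum>i\<in>{True, False}. 1 * T (if i then x else y) l)"
      by (rule adjointable_lin_at[OF wf assms(1) _ X_add[OF wf assms(2,3)] _ True])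
        (use assms in auto)
    then show ?thesis by simp
  next
    case False
    then show ?thesis
      using X_zero_off[OF wf adjointable_X[OF wf assms(1)]] X_add[OF wf] assms(2,3) by simp
  qed
qed

text \<open>The entries in row \<open>l\<close> are the conjugates of the coordinates of the adjoint
  applied to \<open>\<delta> l\<close>, so the series is an inner product. It lets coordinate
  vectors determine an operator without an appeal to continuity.\<close>

lemma adjointable_matrix:
  assumes "T \<in> adjointable_ops (CK_bimodule E)" "z \<in> X E" "l \<in> arcs E"
  shows "T z l = (\<Sum>\<^sub>\<infinity>k\<in>fibre E (head E l). T (\<delta> k) l * z k)"
proof -
  obtain T' where T': "T' \<in> X E \<rightarrow>\<^sub>E X E"
    and adj: "\<forall>x\<in>X E. \<forall>y\<in>X E. ip E (T x) y = ip E x (T' y)"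
    using assms(1) unfolding adjointable_ops_def by blast
  have d: "\<delta> l \<in> X E" by (rule \<delta>_in_X[OF wf assms(3)])
  have *: "T x l = ip E (T' (\<delta> l)) x (head E l)" if "x \<in> X E" for x
  proof -
    have "cnj (T x l) = ip E x (T' (\<delta> l)) (head E l)"
      using adj[rule_format, OF that d] ip_\<delta>_right[OF wf assms(3), of "T x" "head E l"] by simp
    then have "cnj (cnj (T x l)) = cnj (ip E x (T' (\<delta> l)) (head E l))" by (rule arg_cong)
    then show ?thesis by (simp add: cnj_ip)
  qed
  show ?thesis
    unfolding *[OF assms(2)] ip_eq[of _ _ z]
  proof (rule infsum_cong)
    fix k assume "k \<in> fibre E (head E l)"
    then have k: "k \<in> arcs E" "head E l = head E k" by (auto simp: fibre_def)
    have "T (\<delta> k) l = cnj (T' (\<delta> l) k)"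
      unfolding *[OF \<delta>_in_X[OF wf k(1)]] using k by (simp add: ip_\<delta>_right[OF wf k(1)])
    then show "cnj (T' (\<delta> l) k) * z k = T (\<delta> k) l * z k" by simp
  qed
qed

lemma adjointable_eqI:
  assumes "T \<in> adjointable_ops (CK_bimodule E)" "S \<in> adjointable_ops (CK_bimodule E)"
    and "\<And>k. k \<in> arcs E \<Longrightarrow> T (\<delta> k) = S (\<delta> k)"
  shows "T = S"
proof (rule adjointable_ext[OF wf assms(1,2)])
  fix x l assume x: "x \<in> X E" "l \<in> arcs E"
  show "T x l = S x l"
    unfolding adjointable_matrix[OF assms(1) x] adjointable_matrix[OF assms(2) x]
    by (rule infsum_cong) (simp add: assms(3) fibre_def)
qed

text \<open>The squared norm of \<open>T' y\<close> over \<open>v\<close> is the inner product of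
  \<open>T (T' y)\<close> with \<open>y\<close>, hence at most \<open>C\<close> times the norms of
  \<open>T' y\<close> and \<open>y\<close>; one factor cancels unless it is zero.\<close>

lemma adjoint_bound:
  assumes T: "\<And>x. x \<in> X E \<Longrightarrow> T x \<in> X E" "\<And>x. x \<in> X E \<Longrightarrow> T' x \<in> X E"
    and adj: "\<And>x y. x \<in> X E \<Longrightarrow> y \<in> X E \<Longrightarrow> ip E (T x) y = ip E x (T' y)"
    and bd: "\<And>z v. z \<in> X E \<Longrightarrow> fnorm E (T z) v \<le> C * fnorm E z v"
    and y: "y \<in> X E" and "0 \<le> C"
  shows "fnorm E (T' y) v \<le> C * fnorm E y v"
proof -
  let ?n = "fnorm E (T' y) v"
  have "?n\<^sup>2 = cmod (ip E (T' y) (T' y) v)"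
    by (simp add: ip_self[OF wf T(2)[OF y]] norm_power)
  also have "\<dots> = cmod (ip E (T (T' y)) y v)"
    by (simp add: adj T(2) y)
  also have "\<dots> \<le> fnorm E (T (T' y)) v * fnorm E y v"
    by (intro ip_bound[OF wf] T y)
  also have "\<dots> \<le> C * ?n * fnorm E y v"
    by (intro mult_right_mono bd T y) simp
  finally have *: "?n * ?n \<le> ?n * (C * fnorm E y v)"
    by (simp add: power2_eq_square mult_ac)
  show ?thesis
  proof (cases "?n = 0")
    case True
    then show ?thesis using \<open>0 \<le> C\<close> by simp
  next
    case False
    then have "0 < ?n" using l2n_nonneg[of "fibre E v" "T' y"] by linarith
    with * show ?thesis by (rule mult_left_le_imp_le)
  qed
qed

text \<open>The definition provides the adjoint merely as a map. Conjugating the defining identity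
  shows that it has \<open>T\<close> as its own adjoint.\<close>

lemma adjointable_obtain:
  assumes "T \<in> adjointable_ops (CK_bimodule E)"
  shows "\<exists>T' \<in> adjointable_ops (CK_bimodule E).
    \<forall>x\<in>X E. \<forall>y\<in>X E. ip E (T x) y = ip E x (T' y)"
proof -
  obtain T' where T: "T \<in> X E \<rightarrow>\<^sub>E X E" and T': "T' \<in> X E \<rightarrow>\<^sub>E X E"
    and adj: "\<forall>x\<in>X E. \<forall>y\<in>X E. ip E (T x) y = ip E x (T' y)"
    using assms unfolding adjointable_ops_def by blast
  have "ip E (T' x) y = ip E x (T y)" if "x \<in> X E" "y \<in> X E" for x y
  proof
    fix v
    have "ip E (T' x) y v = cnj (ip E y (T' x) v)" by (simp add: cnj_ip)
    also have "\<dots> = cnj (ip E (T y) x v)" using adj that by simp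
    finally show "ip E (T' x) y v = ip E x (T y) v" by (simp add: cnj_ip)
  qed
  then have "T' \<in> adjointable_ops (CK_bimodule E)"
    unfolding adjointable_ops_def using T T' by blast
  then show ?thesis using adj by blast
qed

lemma adjointable_compose:
  assumes "S \<in> adjointable_ops (CK_bimodule E)" "T \<in> adjointable_ops (CK_bimodule E)"
  shows "compose (X E) S T \<in> adjointable_ops (CK_bimodule E)"
proof -
  obtain S' where S': "S' \<in> adjointable_ops (CK_bimodule E)"
    and aS: "\<forall>x\<in>X E. \<forall>y\<in>X E. ip E (S x) y = ip E x (S' y)"
    using adjointable_obtain[OF assms(1)] by blast
  obtain T' where T': "T' \<in> adjointable_ops (CK_bimodule E)"
    and aT: "\<forall>x\<in>X E. \<forall>y\<in>X E. ip E (T x) y = ip E x (T' y)"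
    using adjointable_obtain[OF assms(2)] by blast
  have c: "compose (X E) U V \<in> X E \<rightarrow>\<^sub>E X E"
    if "U \<in> adjointable_ops (CK_bimodule E)" "V \<in> adjointable_ops (CK_bimodule E)" for U V
    using adjointable_X[OF wf that(1)] adjointable_X[OF wf that(2)] by (simp add: compose_def)
  have "ip E (compose (X E) S T x) y = ip E x (compose (X E) T' S' y)"
    if "x \<in> X E" "y \<in> X E" for x y
    using that aS aT adjointable_X[OF wf assms(2)] adjointable_X[OF wf S'] by (simp add: compose_def)
  then show ?thesis
    unfolding adjointable_ops_def using c[OF assms] c[OF T' S'] by blast
qed

end

text \<open>A single multiplication map of the product system, detached from the semigroup. The
  composed graph \<open>T\<close> is a parameter of its own, so that one graph can be decomposed in
  two different ways.\<close>

locale graph_composition =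
  fixes A :: "('v, 'a) pre_digraph" and B :: "('v, 'b) pre_digraph" and T :: "('v, 'c) pre_digraph"
    and f :: "'a \<times> 'b \<Rightarrow> 'c"
  assumes wfA: "wf_digraph A" and wfB: "wf_digraph B" and wfT: "wf_digraph T"
    and bij: "bij_betw f (arcs (fibre_product A B)) (arcs T)"
    and head_f: "x \<in> arcs (fibre_product A B) \<Longrightarrow> head T (f x) = head B (snd x)"
begin

definition fac :: "'c \<Rightarrow> 'a \<times> 'b" where
  "fac = the_inv_into (arcs (fibre_product A B)) f"

definition ini :: "'c \<Rightarrow> 'a" where "ini c = fst (fac c)"
definition fin :: "'c \<Rightarrow> 'b" where "fin c = snd (fac c)"

definition mult :: "('a \<Rightarrow> complex) \<Rightarrow> ('b \<Rightarrow> complex) \<Rightarrow> 'c \<Rightarrow> complex" where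
  "mult x y = (\<lambda>c. if c \<in> arcs T then x (ini c) * y (fin c) else 0)"

text \<open>In the tensor product this is the component of \<open>z\<close> along the edge
  \<open>m\<close> of \<open>B\<close>. Composability puts it in the one fibre of \<open>A\<close>
  over \<open>tail B m\<close>.\<close>

definition slice :: "('c \<Rightarrow> complex) \<Rightarrow> 'b \<Rightarrow> 'a \<Rightarrow> complex" where
  "slice z m = (\<lambda>l. if l \<in> fibre A (tail B m) then z (f (l, m)) else 0)"

text \<open>\<open>X T\<close> is the balanced tensor product of \<open>X A\<close> and \<open>X B\<close>, and \<open>amp S\<close> is \<open>S \<otimes> 1\<close>: the operator \<open>S\<close>
  acts on each slice separately.\<close>

definition amp :: "(('a \<Rightarrow> complex) \<Rightarrow> 'a \<Rightarrow> complex) \<Rightarrow> ('c \<Rightarrow> complex) \<Rightarrow> 'c \<Rightarrow> complex" where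
  "amp S z = (\<lambda>c. if c \<in> arcs T then S (slice z (fin c)) (ini c) else 0)"

section \<open>Fibres and slices of a composition\<close>

lemma pair_iff: "(l, m) \<in> arcs (fibre_product A B) \<longleftrightarrow> m \<in> arcs B \<and> l \<in> fibre A (tail B m)"
  by (auto simp: fibre_product_def fibre_def)

lemma f_arc:
  assumes "m \<in> arcs B" "l \<in> fibre A (tail B m)"
  shows "f (l, m) \<in> arcs T" "ini (f (l, m)) = l" "fin (f (l, m)) = m" "head T (f (l, m)) = head B m"
proof -
  have p: "(l, m) \<in> arcs (fibre_product A B)" using assms by (simp add: pair_iff)
  show "f (l, m) \<in> arcs T" using bij p by (rule bij_betw_apply)
  have "fac (f (l, m)) = (l, m)"
    unfolding fac_def by (rule the_inv_into_f_f[OF bij_betw_imp_inj_on[OF bij] p])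
  then show "ini (f (l, m)) = l" "fin (f (l, m)) = m" by (simp_all add: ini_def fin_def)
  show "head T (f (l, m)) = head B m" using head_f[OF p] by simp
qed

lemma arc_f:
  assumes "c \<in> arcs T"
  shows "fin c \<in> arcs B" "ini c \<in> fibre A (tail B (fin c))" "f (ini c, fin c) = c"
    "head B (fin c) = head T c"
proof -
  have "fac c \<in> arcs (fibre_product A B)"
    unfolding fac_def
    by (rule the_inv_into_into[OF bij_betw_imp_inj_on[OF bij] _ order_refl])
      (use bij assms in \<open>simp add: bij_betw_def\<close>)
  then have p: "(ini c, fin c) \<in> arcs (fibre_product A B)"
    by (simp add: ini_def fin_def)
  show "fin c \<in> arcs B" "ini c \<in> fibre A (tail B (fin c))" using p by (simp_all add: pair_iff)
  show fc: "f (ini c, fin c) = c"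
    unfolding ini_def fin_def fac_def prod.collapse
    by (rule f_the_inv_into_f_bij_betw[OF bij assms])
  show "head B (fin c) = head T c" using head_f[OF p] fc by simp
qed

lemma ini_arc: "c \<in> arcs T \<Longrightarrow> ini c \<in> arcs A"
  using arc_f(2)[of c] by (simp add: fibre_def)

text \<open>A composite edge has the head of its second factor. So the fibre of \<open>T\<close>
  over \<open>v\<close> splits according to the second factor \<open>m\<close> in the fibre of
  \<open>B\<close> over \<open>v\<close>, with first factors from the fibre of \<open>A\<close> over
  the tail of \<open>m\<close>. Sums over fibres of \<open>T\<close> become iterated sums through
  this bijection.\<close>

lemma bij_fibre:
  "bij_betw (\<lambda>(m, l). f (l, m)) (Sigma (fibre B v) (\<lambda>m. fibre A (tail B m))) (fibre T v)"
proof (rule bij_betw_byWitness[where f' = "\<lambda>c. (fin c, ini c)"])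
  show "(\<lambda>(m, l). f (l, m)) ` Sigma (fibre B v) (\<lambda>m. fibre A (tail B m)) \<subseteq> fibre T v"
    using f_arc(1,4) by (auto simp: fibre_def[of B] fibre_def[of T])
  show "(\<lambda>c. (fin c, ini c)) ` fibre T v \<subseteq> Sigma (fibre B v) (\<lambda>m. fibre A (tail B m))"
    using arc_f(1,2,4) by (auto simp: fibre_def[of B] fibre_def[of T])
  show "\<forall>a\<in>Sigma (fibre B v) (\<lambda>m. fibre A (tail B m)).
      (fin (case a of (m, l) \<Rightarrow> f (l, m)), ini (case a of (m, l) \<Rightarrow> f (l, m))) = a"
    using f_arc(2,3) by (auto simp: fibre_def[of B])
  show "\<forall>c\<in>fibre T v. (case (fin c, ini c) of (m, l) \<Rightarrow> f (l, m)) = c"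
    using arc_f(3) by (simp add: fibre_def)
qed

lemma reindex_fibre:
  fixes g :: "'c \<Rightarrow> 'd::{comm_monoid_add, t2_space}"
  shows "(\<lambda>(m, l). g (f (l, m))) summable_on Sigma (fibre B v) (\<lambda>m. fibre A (tail B m)) \<longleftrightarrow>
      g summable_on fibre T v"
    and "infsum (\<lambda>(m, l). g (f (l, m))) (Sigma (fibre B v) (\<lambda>m. fibre A (tail B m))) =
      infsum g (fibre T v)"
proof -
  have eq: "(\<lambda>(m, l). g (f (l, m))) = (\<lambda>x. g ((\<lambda>(m, l). f (l, m)) x))"
    by (rule ext) (simp add: split_def)
  show "(\<lambda>(m, l). g (f (l, m))) summable_on Sigma (fibre B v) (\<lambda>m. fibre A (tail B m)) \<longleftrightarrow>
      g summable_on fibre T v"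
    unfolding eq by (rule summable_on_reindex_bij_betw[OF bij_fibre])
  show "infsum (\<lambda>(m, l). g (f (l, m))) (Sigma (fibre B v) (\<lambda>m. fibre A (tail B m))) =
      infsum g (fibre T v)"
    unfolding eq by (rule infsum_reindex_bij_betw[OF bij_fibre])
qed

lemma infsum_fibre:
  fixes g :: "'c \<Rightarrow> 'd::banach"
  assumes "g summable_on fibre T v"
  shows "\<And>m. m \<in> fibre B v \<Longrightarrow> (\<lambda>l. g (f (l, m))) summable_on fibre A (tail B m)"
    and "(\<lambda>m. \<Sum>\<^sub>\<infinity>l\<in>fibre A (tail B m). g (f (l, m))) summable_on fibre B v"
    and "infsum g (fibre T v) = (\<Sum>\<^sub>\<infinity>m\<in>fibre B v. \<Sum>\<^sub>\<infinity>l\<in>fibre A (tail B m). g (f (l, m)))"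
proof -
  have *: "(\<lambda>(m, l). g (f (l, m))) summable_on Sigma (fibre B v) (\<lambda>m. fibre A (tail B m))"
    by (rule reindex_fibre(1)[THEN iffD2, OF assms])
  show "(\<lambda>l. g (f (l, m))) summable_on fibre A (tail B m)" if "m \<in> fibre B v" for m
  proof -
    have "(\<lambda>(m, l). g (f (l, m))) summable_on Pair m ` fibre A (tail B m)"
      by (rule summable_on_subset_banach[OF *]) (use that in auto)
    then have "((\<lambda>(m, l). g (f (l, m))) \<circ> Pair m) summable_on fibre A (tail B m)"
      by (rule summable_on_reindex[THEN iffD1, rotated]) (simp add: inj_on_def)
    then show ?thesis by (simp add: o_def)
  qed
  show "(\<lambda>m. \<Sum>\<^sub>\<infinity>l\<in>fibre A (tail B m). g (f (l, m))) summable_on fibre B v"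
    using * by (rule summable_on_Sigma_banach[of "\<lambda>m l. g (f (l, m))" "fibre B v" "\<lambda>m. fibre A (tail B m)"])
  show "infsum g (fibre T v) = (\<Sum>\<^sub>\<infinity>m\<in>fibre B v. \<Sum>\<^sub>\<infinity>l\<in>fibre A (tail B m). g (f (l, m)))"
    by (rule trans[OF reindex_fibre(2)[symmetric] infsum_Sigma'_banach[symmetric]]) (rule *)
qed

text \<open>The direction of Tonelli: for nonnegative \<open>g\<close> summability of the iterated
  sums is enough.\<close>

lemma summable_fibreI:
  fixes g :: "'c \<Rightarrow> real"
  assumes "\<And>c. 0 \<le> g c"
    "\<And>m. m \<in> fibre B v \<Longrightarrow> (\<lambda>l. g (f (l, m))) summable_on fibre A (tail B m)"
    "(\<lambda>m. \<Sum>\<^sub>\<infinity>l\<in>fibre A (tail B m). g (f (l, m))) summable_on fibre B v"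
  shows "g summable_on fibre T v"
proof -
  have "(\<lambda>(m, l). g (f (l, m))) summable_on Sigma (fibre B v) (\<lambda>m. fibre A (tail B m))"
    by (rule summable_on_SigmaI[where g = "\<lambda>m. \<Sum>\<^sub>\<infinity>l\<in>fibre A (tail B m). g (f (l, m))"])
      (simp_all add: assms)
  then show ?thesis by (rule reindex_fibre(1)[THEN iffD1])
qed

abbreviation snorm :: "('c \<Rightarrow> complex) \<Rightarrow> 'b \<Rightarrow> real" where
  "snorm z m \<equiv> l2n (fibre A (tail B m)) (slice z m)"

lemma slice_apply:
  "l \<in> fibre A (tail B m) \<Longrightarrow> slice z m l = z (f (l, m))"
  by (simp add: slice_def)

lemma snorm_sq: "(snorm z m)\<^sup>2 = (\<Sum>\<^sub>\<infinity>l\<in>fibre A (tail B m). (cmod (z (f (l, m))))\<^sup>2)"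
  unfolding l2n_sq by (rule infsum_cong) (simp add: slice_def)

lemma sqsum_slice_iff:
  "sqsum (fibre A (tail B m)) (slice z m) \<longleftrightarrow>
    (\<lambda>l. (cmod (z (f (l, m))))\<^sup>2) summable_on fibre A (tail B m)"
  unfolding sqsum_def by (rule summable_on_cong) (simp add: slice_def)

lemma sqsum_sliceD:
  assumes "sqsum (fibre T v) z"
  shows "\<And>m. m \<in> fibre B v \<Longrightarrow> sqsum (fibre A (tail B m)) (slice z m)"
    and "(\<lambda>m. (snorm z m)\<^sup>2) summable_on fibre B v"
    and "(fnorm T z v)\<^sup>2 = (\<Sum>\<^sub>\<infinity>m\<in>fibre B v. (snorm z m)\<^sup>2)"
  using infsum_fibre[OF assms[unfolded sqsum_def]]
  by (simp_all only: sqsum_slice_iff snorm_sq l2n_sq[of _ z])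

lemma sqsum_sliceI:
  assumes "\<And>m. m \<in> fibre B v \<Longrightarrow> sqsum (fibre A (tail B m)) (slice z m)"
    and "(\<lambda>m. (snorm z m)\<^sup>2) summable_on fibre B v"
  shows "sqsum (fibre T v) z"
  unfolding sqsum_def
  by (rule summable_fibreI) (use assms in \<open>simp_all only: sqsum_slice_iff snorm_sq zero_le_power2\<close>)

lemma slice_X:
  assumes "z \<in> X T" "m \<in> arcs B"
  shows "slice z m \<in> X A"
proof (rule X_single[OF wfA])
  show "slice z m l = 0" if "l \<notin> fibre A (tail B m)" for l using that by (simp add: slice_def)
  show "sqsum (fibre A (tail B m)) (slice z m)"
    by (rule sqsum_sliceD(1)[OF X_sqsum[OF wfT assms(1)], of _ "head B m"])
      (use assms(2) in \<open>simp add: fibre_def\<close>)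
qed

text \<open>The comparison function \<open>g\<close> lives on the edges of \<open>B\<close>. It is
  the second factor \<open>y\<close> when products of vectors are estimated, and the function of
  slice norms of a vector when amplifications are.\<close>

lemma slice_dom:
  assumes w: "\<And>c. c \<notin> arcs T \<Longrightarrow> w c = 0" and "0 \<le> C"
    and "\<And>m. m \<in> arcs B \<Longrightarrow> sqsum (fibre A (tail B m)) (slice w m)"
    and g: "sqsum (fibre B v) g"
    and le: "\<And>m. m \<in> fibre B v \<Longrightarrow> snorm w m \<le> C * cmod (g m)"
  shows "sqsum (fibre T v) w" "fnorm T w v \<le> C * fnorm B g v"
proof -
  have s: "(\<lambda>m. C\<^sup>2 * (cmod (g m))\<^sup>2) summable_on fibre B v"
    by (rule summable_on_cmult_right) (use g in \<open>simp add: sqsum_def\<close>)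
  have le2: "(snorm w m)\<^sup>2 \<le> C\<^sup>2 * (cmod (g m))\<^sup>2" if "m \<in> fibre B v" for m
    using power_mono[OF le[OF that] l2n_nonneg, of 2] by (simp add: power_mult_distrib)
  have sw: "(\<lambda>m. (snorm w m)\<^sup>2) summable_on fibre B v"
    by (rule summable_on_comparison_test[OF s le2]) simp_all
  show sqw: "sqsum (fibre T v) w"
    by (rule sqsum_sliceI[OF _ sw]) (use assms(3) in \<open>simp add: fibre_def[of B]\<close>)
  have "(fnorm T w v)\<^sup>2 \<le> (\<Sum>\<^sub>\<infinity>m\<in>fibre B v. C\<^sup>2 * (cmod (g m))\<^sup>2)"
    unfolding sqsum_sliceD(3)[OF sqw] by (rule infsum_mono[OF sw s le2])
  also have "\<dots> = C\<^sup>2 * (fnorm B g v)\<^sup>2"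
    unfolding l2n_sq[of _ g] by (rule infsum_cmult_right) (use g in \<open>simp add: sqsum_def\<close>)
  finally have "(fnorm T w v)\<^sup>2 \<le> (C * fnorm B g v)\<^sup>2" by (simp add: power_mult_distrib)
  then show "fnorm T w v \<le> C * fnorm B g v"
    by (rule power2_le_imp_le) (simp add: \<open>0 \<le> C\<close>)
qed

lemma slice_dom_slice:
  assumes w: "\<And>c. c \<notin> arcs T \<Longrightarrow> w c = 0" and "0 \<le> C" and z: "z \<in> X T"
    and "\<And>m. m \<in> arcs B \<Longrightarrow> sqsum (fibre A (tail B m)) (slice w m)"
    and le: "\<And>m. m \<in> arcs B \<Longrightarrow> snorm w m \<le> C * snorm z m"
  shows "w \<in> X T" "fnorm T w v \<le> C * fnorm T z v"
proof -
  have c: "(cmod (complex_of_real (snorm z m)))\<^sup>2 = (snorm z m)\<^sup>2" for m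
    by (simp only: norm_of_real power2_abs)
  have g: "sqsum (fibre B v) (\<lambda>m. of_real (snorm z m))" for v
    unfolding sqsum_def c by (rule sqsum_sliceD(2)[OF X_sqsum[OF wfT z]])
  \<comment> \<open>Parseval: the slice norms of \<open>z\<close>, taken as a function on the edges
    of \<open>B\<close>, have the same fibre norms as \<open>z\<close>.\<close>
  have gn: "fnorm B (\<lambda>m. of_real (snorm z m)) v = fnorm T z v" for v
    by (rule power2_eq_imp_eq)
      (simp_all only: l2n_sq[of "fibre B v"] c sqsum_sliceD(3)[OF X_sqsum[OF wfT z]] l2n_nonneg)
  have cm: "cmod (complex_of_real (snorm z m)) = snorm z m" for m
    by (simp only: norm_of_real abs_of_nonneg[OF l2n_nonneg])
  have le': "snorm w m \<le> C * cmod (complex_of_real (snorm z m))" if "m \<in> fibre B v" for m v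
    unfolding cm by (rule le) (use that in \<open>simp add: fibre_def\<close>)
  have 1: "sqsum (fibre T v) w" for v
    by (rule slice_dom(1)[OF w assms(2,4) g le']; assumption)
  have 2: "fnorm T w v \<le> C * fnorm T z v" for v
    unfolding gn[symmetric] by (rule slice_dom(2)[OF w assms(2,4) g le']; assumption)
  show "fnorm T w v \<le> C * fnorm T z v" by (rule 2)
  show "w \<in> X T"
  proof (rule X_domI[OF wfT z X_zero[OF wfT] w])
    show "fnorm T w v \<le> C * (fnorm T z v + fnorm T (\<lambda>_. 0) v)" for v
      using 2[of v] by (simp add: l2n_zero)
  qed (use 1 in simp_all)
qed

lemma slice_amp:
  assumes "m \<in> arcs B" "l \<in> fibre A (tail B m)"
  shows "slice (amp S z) m l = S (slice z m) l"
  unfolding slice_apply[OF assms(2)] using f_arc[OF assms] by (simp add: amp_def)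

text \<open>A slice lies in one fibre of \<open>A\<close>, so the fibrewise bound for
  \<open>S\<close> applies to each slice with the same \<open>C\<close>, and the squares add up over
  \<open>m\<close>. Here \<open>S\<close> is any map with such a bound, so an operator preceded or
  followed by a cut is covered too.\<close>

lemma amp_bound:
  assumes S: "\<And>x. x \<in> X A \<Longrightarrow> S x \<in> X A" and "0 \<le> C"
    and bd: "\<And>x v. x \<in> X A \<Longrightarrow> fnorm A (S x) v \<le> C * fnorm A x v"
    and z: "z \<in> X T"
  shows "amp S z \<in> X T" "fnorm T (amp S z) v \<le> C * fnorm T z v"
proof -
  have off: "amp S z c = 0" if "c \<notin> arcs T" for c using that by (simp add: amp_def)
  have sq_eq: "sqsum (fibre A (tail B m)) (slice (amp S z) m) \<longleftrightarrow> sqsum (fibre A (tail B m)) (S (slice z m))"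
    and n_eq: "snorm (amp S z) m = l2n (fibre A (tail B m)) (S (slice z m))" if "m \<in> arcs B" for m
    by (rule sqsum_cong, rule slice_amp[OF that], assumption) (rule l2n_cong, rule slice_amp[OF that], assumption)
  have 1: "sqsum (fibre A (tail B m)) (slice (amp S z) m)" if "m \<in> arcs B" for m
    unfolding sq_eq[OF that]
    by (rule X_sqsum[OF wfA S[OF slice_X[OF z that]]])
  have 2: "snorm (amp S z) m \<le> C * snorm z m" if "m \<in> arcs B" for m
    unfolding n_eq[OF that]
    by (rule bd[OF slice_X[OF z that]])
  show "amp S z \<in> X T"
    by (rule slice_dom_slice(1)[OF off \<open>0 \<le> C\<close> z 1 2]; assumption)
  show "fnorm T (amp S z) v \<le> C * fnorm T z v"
    by (rule slice_dom_slice(2)[OF off \<open>0 \<le> C\<close> z 1 2]; assumption)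
qed

lemma ip_slice:
  assumes "x \<in> X T" "y \<in> X T"
  shows "ip T x y v = (\<Sum>\<^sub>\<infinity>m\<in>fibre B v. ip A (slice x m) (slice y m) (tail B m))"
proof -
  have "(\<lambda>c. cnj (x c) * y c) summable_on fibre T v"
    using l2_cauchy_schwarz(1)[OF X_sqsum[OF wfT assms(1)] X_sqsum[OF wfT assms(2)]]
    by (rule abs_summable_summable)
  from infsum_fibre(3)[OF this] show ?thesis
    unfolding ip_eq by (simp add: slice_def cong: infsum_cong)
qed

text \<open>The adjoint is the amplification of the adjoint \<open>S'\<close>. It maps into
  \<open>X T\<close> because \<open>S'\<close> inherits the bound \<open>C\<close> from
  \<open>S\<close>; the adjoint identity is then checked slice by slice.\<close>

lemma amp_adjointable:
  assumes S: "S \<in> adjointable_ops (CK_bimodule A)" and "0 \<le> C"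
    and bd: "\<And>x v. x \<in> X A \<Longrightarrow> fnorm A (S x) v \<le> C * fnorm A x v"
  shows "restrict (amp S) (X T) \<in> adjointable_ops (CK_bimodule T)"
proof -
  obtain S' where S': "S' \<in> adjointable_ops (CK_bimodule A)"
    and adj: "\<forall>x\<in>X A. \<forall>y\<in>X A. ip A (S x) y = ip A x (S' y)"
    using adjointable_obtain[OF wfA S] by blast
  note SX = adjointable_X[OF wfA S] and SX' = adjointable_X[OF wfA S']
  have bd': "fnorm A (S' x) v \<le> C * fnorm A x v" if "x \<in> X A" for x v
    by (rule adjoint_bound[OF wfA SX SX' adj[rule_format] bd that \<open>0 \<le> C\<close>]; assumption)
  have aX1: "amp S z \<in> X T" if "z \<in> X T" for z
    by (rule amp_bound(1)[OF SX \<open>0 \<le> C\<close> bd that]; assumption)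
  have aX2: "amp S' z \<in> X T" if "z \<in> X T" for z
    by (rule amp_bound(1)[OF SX' \<open>0 \<le> C\<close> bd' that]; assumption)
  have "ip T (amp S x) y v = ip T x (amp S' y) v" if "x \<in> X T" "y \<in> X T" for x y v
    unfolding ip_slice[OF aX1[OF that(1)] that(2)] ip_slice[OF that(1) aX2[OF that(2)]]
  proof (rule infsum_cong)
    fix m assume "m \<in> fibre B v"
    then have m: "m \<in> arcs B" by (simp add: fibre_def)
    have "ip A (slice (amp S x) m) (slice y m) (tail B m) = ip A (S (slice x m)) (slice y m) (tail B m)"
      by (rule ip_cong) (simp_all add: slice_amp[OF m])
    also have "\<dots> = ip A (slice x m) (S' (slice y m)) (tail B m)"
      using adj slice_X[OF that(1) m] slice_X[OF that(2) m] by simp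
    also have "\<dots> = ip A (slice x m) (slice (amp S' y) m) (tail B m)"
      by (rule ip_cong) (simp_all add: slice_amp[OF m])
    finally show "ip A (slice (amp S x) m) (slice y m) (tail B m)
        = ip A (slice x m) (slice (amp S' y) m) (tail B m)" .
  qed
  then have "\<forall>x\<in>X T. \<forall>y\<in>X T. ip T (restrict (amp S) (X T) x) y = ip T x (restrict (amp S') (X T) y)"
    by (simp add: fun_eq_iff)
  moreover have "restrict (amp S) (X T) \<in> X T \<rightarrow>\<^sub>E X T" "restrict (amp S') (X T) \<in> X T \<rightarrow>\<^sub>E X T"
    using aX1 aX2 by simp_all
  ultimately show ?thesis
    unfolding adjointable_ops_def by blast
qed

section \<open>Products of vectors and uniqueness of the amplification\<close>

lemma slice_mult:
  assumes "m \<in> arcs B" "l \<in> fibre A (tail B m)"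
  shows "slice (mult x y) m l = y m * x l"
  unfolding slice_apply[OF assms(2)] using f_arc[OF assms] by (simp add: mult_def)

lemma mult_X:
  assumes x: "x \<in> X A" and y: "y \<in> X B"
  shows "mult x y \<in> X T"
proof -
  obtain C where C: "0 \<le> C" "\<And>v. fnorm A x v \<le> C" using X_bounded[OF wfA x] by blast
  have off: "mult x y c = 0" if "c \<notin> arcs T" for c using that by (simp add: mult_def)
  have sq_eq: "sqsum (fibre A (tail B m)) (slice (mult x y) m) \<longleftrightarrow> sqsum (fibre A (tail B m)) (\<lambda>l. y m * x l)"
    and n_eq: "snorm (mult x y) m = l2n (fibre A (tail B m)) (\<lambda>l. y m * x l)" if "m \<in> arcs B" for m
    by (rule sqsum_cong, rule slice_mult[OF that], assumption) (rule l2n_cong, rule slice_mult[OF that], assumption)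
  have 1: "sqsum (fibre A (tail B m)) (slice (mult x y) m)" if "m \<in> arcs B" for m
    unfolding sq_eq[OF that]
    by (rule l2n_cmult(1)[OF X_sqsum[OF wfA x]])
  have 2: "snorm (mult x y) m \<le> C * cmod (y m)" if "m \<in> fibre B v" for m v
  proof -
    have m: "m \<in> arcs B" using that by (simp add: fibre_def)
    have "snorm (mult x y) m = cmod (y m) * fnorm A x (tail B m)"
      unfolding n_eq[OF m]
      by (rule l2n_cmult(2))
    then show ?thesis using mult_left_mono[OF C(2), of "cmod (y m)" "tail B m"]
      by (simp add: mult.commute)
  qed
  note * = slice_dom[OF off C(1) 1 X_sqsum[OF wfB y] 2]
  \<comment> \<open>\<open>X_domI\<close> compares vectors of the same module, but here the
    dominating vector \<open>y\<close> belongs to \<open>X B\<close>. The condition at infinity is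
    therefore transferred by hand, over the common vertices.\<close>
  show ?thesis
    unfolding X_iff[OF wfT]
  proof (intro conjI allI impI)
    fix \<epsilon> :: real assume "\<epsilon> > 0"
    \<comment> \<open>Aiming at half of \<epsilon> turns the resulting weak inequality into a strict
      one.\<close>
    obtain \<eta> where \<eta>: "\<eta> > 0" "C * \<eta> \<le> \<epsilon> / 2" using real_div_small[OF half_gt_zero[OF \<open>\<epsilon> > 0\<close>] C(1)] by blast
    have "{v. \<epsilon> \<le> fnorm T (mult x y) v} \<subseteq> {v. \<eta> \<le> fnorm B y v}"
    proof (rule subsetI, rule ccontr)
      fix v assume v: "v \<in> {v. \<epsilon> \<le> fnorm T (mult x y) v}" "v \<notin> {v. \<eta> \<le> fnorm B y v}"
      have "C * fnorm B y v \<le> C * \<eta>" using v(2) C(1) by (intro mult_left_mono) simp_all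
      with v(1) *(2)[of v] \<eta>(2) \<open>\<epsilon> > 0\<close> show False by simp
    qed
    moreover have "finite {v. \<eta> \<le> fnorm B y v}" using y \<eta>(1) by (simp add: X_iff[OF wfB])
    ultimately show "finite {v. \<epsilon> \<le> fnorm T (mult x y) v}" by (rule finite_subset)
  qed (use off *(1) in simp_all)
qed

lemma amp_mult:
  assumes S: "S \<in> adjointable_ops (CK_bimodule A)" and x: "x \<in> X A" and y: "y \<in> X B"
  shows "amp S (mult x y) = mult (S x) y"
proof
  fix c
  show "amp S (mult x y) c = mult (S x) y c"
  proof (cases "c \<in> arcs T")
    case True
    note c = arc_f[OF True]
    have h: "head A (ini c) = tail B (fin c)" "ini c \<in> arcs A" using c(2) by (simp_all add: fibre_def)
    \<comment> \<open>The slice agrees with the multiple \<open>y (fin c)\<close> of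
      \<open>x\<close> only on the fibre over \<open>tail B (fin c)\<close>, but \<open>S\<close> at
      \<open>ini c\<close> sees nothing else.\<close>
    have "S (slice (mult x y) (fin c)) (ini c) = (\<Sum>i\<in>{()}. y (fin c) * S x (ini c))"
      by (rule adjointable_lin_at[OF wfA S _ slice_X[OF mult_X[OF x y] c(1)] _ h(2)])
        (use x slice_mult[OF c(1)] in \<open>simp_all add: h(1)\<close>)
    then show ?thesis using True by (simp add: amp_def mult_def)
  qed (simp add: amp_def mult_def)
qed

lemma mult_\<delta>:
  assumes "c \<in> arcs T"
  shows "mult (\<delta> (ini c)) (\<delta> (fin c)) = \<delta> c"
proof
  fix k
  show "mult (\<delta> (ini c)) (\<delta> (fin c)) k = \<delta> c k"
  proof (cases "k \<in> arcs T")
    case True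
    have "ini k = ini c \<and> fin k = fin c \<longleftrightarrow> k = c"
    proof
      assume "ini k = ini c \<and> fin k = fin c"
      then have "f (ini k, fin k) = f (ini c, fin c)" by simp
      then show "k = c" by (simp only: arc_f(3)[OF True] arc_f(3)[OF assms])
    qed simp
    with True show ?thesis unfolding mult_def \<delta>_def by (cases "k = c") auto
  next
    case False
    then have "k \<noteq> c" using assms by blast
    with False show ?thesis by (simp add: mult_def \<delta>_def)
  qed
qed

text \<open>Every coordinate vector of \<open>T\<close> is a product by
  \<open>mult_\<delta>\<close>. So the condition on products fixes an operator on all coordinate
  vectors, and adjointability does the rest.\<close>

lemma amp_unique:
  assumes S: "S \<in> adjointable_ops (CK_bimodule A)" and "0 \<le> C"
    and bd: "\<And>x v. x \<in> X A \<Longrightarrow> fnorm A (S x) v \<le> C * fnorm A x v"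
  shows "(THE R. R \<in> adjointable_ops (CK_bimodule T) \<and>
      (\<forall>x\<in>X A. \<forall>y\<in>X B. R (mult x y) = mult (S x) y)) = restrict (amp S) (X T)"
proof (rule the_equality, intro conjI ballI)
  show adj: "restrict (amp S) (X T) \<in> adjointable_ops (CK_bimodule T)"
    by (rule amp_adjointable[OF assms]; assumption)
  show m: "restrict (amp S) (X T) (mult x y) = mult (S x) y" if "x \<in> X A" "y \<in> X B" for x y
    using mult_X[OF that] amp_mult[OF S that] by simp
  fix R assume R: "R \<in> adjointable_ops (CK_bimodule T) \<and>
      (\<forall>x\<in>X A. \<forall>y\<in>X B. R (mult x y) = mult (S x) y)"
  show "R = restrict (amp S) (X T)"
  proof (rule adjointable_eqI[OF wfT conjunct1[OF R] adj])
    fix c assume c: "c \<in> arcs T"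
    have d: "\<delta> (ini c) \<in> X A" "\<delta> (fin c) \<in> X B"
      by (rule \<delta>_in_X[OF wfA ini_arc[OF c]]) (rule \<delta>_in_X[OF wfB arc_f(1)[OF c]])
    show "R (\<delta> c) = restrict (amp S) (X T) (\<delta> c)"
      using conjunct2[OF R] d m[OF d] unfolding mult_\<delta>[OF c, symmetric] by simp
  qed
qed

end

section \<open>Compact alignment and finite alignment\<close>

text \<open>In the application \<open>T\<close> is the graph over p \<or> q, with \<open>A\<close>
  and \<open>B\<close> the graphs over p and q. Then \<open>common_arcs l m\<close> is the set of
  minimal common extensions of \<open>l\<close> and \<open>m\<close>.\<close>

locale two_compositions =
  L: graph_composition A A' T f + R: graph_composition B B' T g
  for A :: "('v, 'a) pre_digraph" and A' :: "('v, 'b) pre_digraph" and T :: "('v, 'c) pre_digraph"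
    and f :: "'a \<times> 'b \<Rightarrow> 'c"
    and B :: "('v, 'd) pre_digraph" and B' :: "('v, 'e) pre_digraph" and g :: "'d \<times> 'e \<Rightarrow> 'c"
begin

abbreviation amp_comp where
  "amp_comp S U \<equiv> compose (X T) (restrict (L.amp S) (X T)) (restrict (R.amp U) (X T))"

abbreviation common_arcs where
  "common_arcs l m \<equiv> {c \<in> arcs T. L.ini c = l \<and> R.ini c = m}"

lemma finite_common_arcs_imp_compact:
  assumes Sc: "S \<in> compact_ops (CK_bimodule A)" and Uc: "U \<in> compact_ops (CK_bimodule B)"
    and fin: "\<And>l m. l \<in> arcs A \<Longrightarrow> m \<in> arcs B \<Longrightarrow> finite (common_arcs l m)"
  shows "amp_comp S U \<in> compact_ops (CK_bimodule T)"
proof -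
  have S: "S \<in> adjointable_ops (CK_bimodule A)" and U: "U \<in> adjointable_ops (CK_bimodule B)"
    using Sc Uc by (simp_all add: compact_ops_def)
  note SX = adjointable_X[OF L.wfA S] and UX = adjointable_X[OF R.wfA U]
  obtain a where a: "0 \<le> a" "\<And>z v. z \<in> X A \<Longrightarrow> fnorm A (S z) v \<le> a * fnorm A z v"
    using compact_bounded[OF L.wfA Sc] by blast
  obtain b where b: "0 \<le> b" "\<And>z v. z \<in> X B \<Longrightarrow> fnorm B (U z) v \<le> b * fnorm B z v"
    using compact_bounded[OF R.wfA Uc] by blast
  define RS where "RS = restrict (L.amp S) (X T)"
  define RU where "RU = restrict (R.amp U) (X T)"
  have RS: "RS \<in> adjointable_ops (CK_bimodule T)"
    unfolding RS_def by (rule L.amp_adjointable[OF S a]; assumption)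
  have RU: "RU \<in> adjointable_ops (CK_bimodule T)"
    unfolding RU_def by (rule R.amp_adjointable[OF U b]; assumption)
  note RSX = adjointable_X[OF L.wfT RS] and RUX = adjointable_X[OF L.wfT RU]
  have RS_bd: "fnorm T (RS z) v \<le> a * fnorm T z v" if "z \<in> X T" for z v
    unfolding RS_def restrict_apply'[OF that] by (rule L.amp_bound(2)[OF SX a that]; assumption)
  have RU_bd: "fnorm T (RU z) v \<le> b * fnorm T z v" if "z \<in> X T" for z v
    unfolding RU_def restrict_apply'[OF that] by (rule R.amp_bound(2)[OF UX b that]; assumption)
  obtain RU' where RU': "RU' \<in> adjointable_ops (CK_bimodule T)"
    and adj: "\<forall>x\<in>X T. \<forall>y\<in>X T. ip T (RU x) y = ip T x (RU' y)"
    using adjointable_obtain[OF L.wfT RU] by blast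
  \<comment> \<open>Coordinate \<open>c\<close> of \<open>RU z\<close> is an inner product with
    \<open>z\<close>. This supplies the right vectors of the approximating rank one
    operators.\<close>
  have ip_RU': "ip T (RU' (\<delta> c)) z v = (if v = head T c then RU z c else 0)"
    if "c \<in> arcs T" "z \<in> X T" for c z v
  proof -
    have "ip T (RU' (\<delta> c)) z v = cnj (ip T z (RU' (\<delta> c)) v)" by (simp add: cnj_ip)
    also have "\<dots> = cnj (ip T (RU z) (\<delta> c) v)"
      using adj that(2) \<delta>_in_X[OF L.wfT that(1)] by simp
    finally show ?thesis by (simp add: ip_\<delta>_right[OF L.wfT that(1)])
  qed
  have cutX: "(\<lambda>l. if Q l then 0 else x l) \<in> X E" if "wf_digraph E" "x \<in> X E"
    for Q and x and E :: "('w, 'k) pre_digraph"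
  proof -
    have "(\<lambda>l. if Q l then 0 else x l) = (\<lambda>l. if \<not> Q l then x l else 0)" by (rule ext) simp
    then show ?thesis using X_cut(1)[OF that, of "\<lambda>l. \<not> Q l"] by simp
  qed
  have "compose (X T) RS RU \<in> compact_ops (CK_bimodule T)"
  proof (rule compactI[OF L.wfT adjointable_compose[OF L.wfT RS RU]])
    fix \<epsilon> :: real assume "\<epsilon> > 0"
    \<comment> \<open>There are two errors: a tail of size \<eta> after \<open>U\<close>, enlarged
      by the bound \<open>a\<close> of \<open>S\<close>, and a tail of size \<eta> before
      \<open>S\<close>, enlarged by the bound \<open>b\<close> of \<open>U\<close>.\<close>
    obtain \<eta> where \<eta>: "\<eta> > 0" "(a + b) * \<eta> \<le> \<epsilon>"
      using real_div_small[OF \<open>\<epsilon> > 0\<close>, of "a + b"] a(1) b(1) by auto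
    from compact_tail_small[OF L.wfA Sc \<eta>(1)] obtain F where F: "finite F" "F \<subseteq> arcs A"
      and F_le: "\<forall>z\<in>X A. \<forall>v. fnorm A (S (\<lambda>l. if l \<in> F then 0 else z l)) v \<le> \<eta> * fnorm A z v"
      by blast
    from compact_tail_small[OF R.wfA Uc \<eta>(1)] obtain H where H: "finite H" "H \<subseteq> arcs B"
      and H_le: "\<forall>z\<in>X B. \<forall>v. fnorm B (\<lambda>l. if l \<in> H then 0 else U z l) v \<le> \<eta> * fnorm B z v"
      by blast
    define D where "D = {c \<in> arcs T. L.ini c \<in> F \<and> R.ini c \<in> H}"
    have D: "D \<subseteq> arcs T" by (auto simp: D_def)
    have "finite (\<Union>l\<in>F. \<Union>m\<in>H. common_arcs l m)"
      using F H fin by (intro finite_UN_I) auto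
    moreover have "D \<subseteq> (\<Union>l\<in>F. \<Union>m\<in>H. common_arcs l m)" by (auto simp: D_def)
    ultimately have finD: "finite D" by (rule finite_subset[rotated])
    have dX: "RS (\<delta> c) \<in> X T" "RU' (\<delta> c) \<in> X T" if "c \<in> D" for c
      using RSX adjointable_X[OF L.wfT RU'] \<delta>_in_X[OF L.wfT subsetD[OF D that]] by blast+
    have bound: "fnorm T (\<lambda>l. compose (X T) RS RU z l
        - (\<Sum>c\<in>D. RS (\<delta> c) l * ip T (RU' (\<delta> c)) z (head T l))) v \<le> \<epsilon> * fnorm T z v"
      if z: "z \<in> X T" for z v
    proof -
      define w where "w = RU z"
      \<comment> \<open>The vector \<open>w\<close> is split by disjoint sets of edges:
        \<open>w1\<close> has its \<open>B\<close>-part outside \<open>H\<close>, \<open>w2\<close>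
        has it inside \<open>H\<close> but its \<open>A\<close>-part outside \<open>F\<close>, and
        \<open>u\<close> is what remains on the finite set \<open>D\<close>.\<close>
      define w1 where "w1 = (\<lambda>c. if R.ini c \<in> H then 0 else w c)"
      define w3 where "w3 = (\<lambda>c. if R.ini c \<in> H then w c else 0)"
      define w2 where "w2 = (\<lambda>c. if L.ini c \<in> F then 0 else w3 c)"
      define u where "u = (\<lambda>c. if c \<in> D then w c else 0)"
      have w: "w \<in> X T" unfolding w_def by (rule RUX[OF z])
      have w3: "w3 \<in> X T" "fnorm T w3 v \<le> fnorm T w v"
        unfolding w3_def by (rule X_cut[OF L.wfT w])+
      have w1: "w1 \<in> X T" unfolding w1_def by (rule cutX[OF L.wfT w])
      have w2: "w2 \<in> X T" unfolding w2_def by (rule cutX[OF L.wfT w3(1)])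
      have u: "u \<in> X T" unfolding u_def by (rule X_cut(1)[OF L.wfT w])
      have "w c = w1 c + (w2 c + u c)" for c
        using X_zero_off[OF L.wfT w, of c]
        by (cases "c \<in> arcs T") (simp_all add: w1_def w2_def w3_def u_def D_def)
      then have "w = (\<lambda>c. w1 c + (w2 c + u c))" by (rule ext)
      then have "RS w = RS (\<lambda>c. w1 c + (w2 c + u c))" by (rule arg_cong)
      also have "\<dots> = (\<lambda>c. RS w1 c + (RS w2 c + RS u c))"
        unfolding adjointable_add[OF L.wfT RS w1 X_add[OF L.wfT w2 u]]
          adjointable_add[OF L.wfT RS w2 u] ..
      finally have RSw: "RS w = (\<lambda>c. RS w1 c + (RS w2 c + RS u c))" .
      \<comment> \<open>As \<open>u\<close> is a finite combination of coordinate vectors with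
        coefficients read off by \<open>RU'\<close>, its image is exactly the finite rank operator
        applied to \<open>z\<close>.\<close>
      have RSu: "RS u l = (\<Sum>c\<in>D. RS (\<delta> c) l * ip T (RU' (\<delta> c)) z (head T l))" for l
      proof (cases "l \<in> arcs T")
        case True
        have "RS u l = (\<Sum>c\<in>D. ip T (RU' (\<delta> c)) z (head T l) * RS (\<delta> c) l)"
        proof (rule adjointable_lin_at[OF L.wfT RS finD u _ True])
          show "\<delta> c \<in> X T" if "c \<in> D" for c by (rule \<delta>_in_X[OF L.wfT subsetD[OF D that]])
          fix k assume "k \<in> fibre T (head T l)"
          then have k: "head T k = head T l" by (simp add: fibre_def)
          have "(\<Sum>c\<in>D. ip T (RU' (\<delta> c)) z (head T l) * \<delta> c k)
              = (\<Sum>c\<in>D. if c = k then w k else 0)"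
          proof (rule sum.cong[OF refl])
            fix c assume "c \<in> D"
            then have "c \<in> arcs T" using D by blast
            then show "ip T (RU' (\<delta> c)) z (head T l) * \<delta> c k = (if c = k then w k else 0)"
              using ip_RU'[OF _ z] k by (simp add: \<delta>_def w_def)
          qed
          also have "\<dots> = u k" using finD by (simp add: u_def)
          finally show "u k = (\<Sum>c\<in>D. ip T (RU' (\<delta> c)) z (head T l) * \<delta> c k)" by (rule sym)
        qed
        then show ?thesis by (simp add: mult.commute)
      next
        case False
        have "RS u l = 0" by (rule X_zero_off[OF L.wfT RSX[OF u] False])
        moreover have "RS (\<delta> c) l = 0" if "c \<in> D" for c
          by (rule X_zero_off[OF L.wfT dX(1)[OF that] False])
        ultimately show ?thesis by simp
      qed
      have eq: "(\<lambda>l. compose (X T) RS RU z l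
          - (\<Sum>c\<in>D. RS (\<delta> c) l * ip T (RU' (\<delta> c)) z (head T l))) = (\<lambda>l. RS w1 l + RS w2 l)"
        unfolding RSu[symmetric] compose_eq[OF z] w_def[symmetric] RSw by (rule ext) simp
      have w1_le: "fnorm T w1 v \<le> \<eta> * fnorm T z v"
      proof -
        \<comment> \<open>Cutting \<open>T\<close> by the initial part is the amplification of
          cutting \<open>B\<close>, so \<open>w1\<close> is the amplification of \<open>U\<close>
          followed by a cut and the output tail bound applies.\<close>
        have "w1 = R.amp (\<lambda>y l. if l \<in> H then 0 else U y l) z"
        proof
          fix c
          show "w1 c = R.amp (\<lambda>y l. if l \<in> H then 0 else U y l) z c"
            using z by (simp add: w1_def w_def RU_def R.amp_def)
        qed
        moreover have "fnorm T (R.amp (\<lambda>y l. if l \<in> H then 0 else U y l) z) v \<le> \<eta> * fnorm T z v"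
        proof (rule R.amp_bound(2)[OF _ _ _ z])
          show "(\<lambda>l. if l \<in> H then 0 else U y l) \<in> X B" if "y \<in> X B" for y
            by (rule cutX[OF R.wfA UX[OF that]])
          show "fnorm B (\<lambda>l. if l \<in> H then 0 else U y l) v \<le> \<eta> * fnorm B y v" if "y \<in> X B" for y v
            using H_le that by blast
        qed (use \<eta>(1) in simp)
        ultimately show ?thesis by simp
      qed
      have w2_le: "fnorm T (RS w2) v \<le> \<eta> * fnorm T w3 v"
      proof -
        have sl: "L.slice w2 m = (\<lambda>l. if l \<in> F then 0 else L.slice w3 m l)" if "m \<in> arcs A'" for m
        proof
          fix l
          show "L.slice w2 m l = (if l \<in> F then 0 else L.slice w3 m l)"
            using L.f_arc(2)[OF that, of l] by (simp add: L.slice_def w2_def)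
        qed
        \<comment> \<open>Likewise the cut outside \<open>F\<close> acts inside each slice, before
          \<open>S\<close>, and the input tail bound applies.\<close>
        have "RS w2 = L.amp (\<lambda>y. S (\<lambda>l. if l \<in> F then 0 else y l)) w3"
        proof
          fix c
          show "RS w2 c = L.amp (\<lambda>y. S (\<lambda>l. if l \<in> F then 0 else y l)) w3 c"
            using w2 sl[OF L.arc_f(1)] by (simp add: RS_def L.amp_def)
        qed
        moreover have "fnorm T (L.amp (\<lambda>y. S (\<lambda>l. if l \<in> F then 0 else y l)) w3) v \<le> \<eta> * fnorm T w3 v"
        proof (rule L.amp_bound(2)[OF _ _ _ w3(1)])
          show "S (\<lambda>l. if l \<in> F then 0 else y l) \<in> X A" if "y \<in> X A" for y
            by (rule SX[OF cutX[OF L.wfA that]])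
          show "fnorm A (S (\<lambda>l. if l \<in> F then 0 else y l)) v \<le> \<eta> * fnorm A y v" if "y \<in> X A" for y v
            using F_le that by blast
        qed (use \<eta>(1) in simp)
        ultimately show ?thesis by simp
      qed
      have "fnorm T (\<lambda>l. RS w1 l + RS w2 l) v \<le> fnorm T (RS w1) v + fnorm T (RS w2) v"
        by (rule l2n_triangle(2)[OF X_sqsum[OF L.wfT RSX[OF w1]] X_sqsum[OF L.wfT RSX[OF w2]]])
      also have "fnorm T (RS w1) v \<le> a * (\<eta> * fnorm T z v)"
        by (rule order_trans[OF RS_bd[OF w1] mult_left_mono[OF w1_le a(1)]])
      also have "fnorm T (RS w2) v \<le> \<eta> * (b * fnorm T z v)"
        by (rule order_trans[OF w2_le mult_left_mono[OF order_trans[OF w3(2)]]])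
          (use \<eta>(1) RU_bd[OF z] in \<open>simp_all add: w_def\<close>)
      also have "a * (\<eta> * fnorm T z v) + \<eta> * (b * fnorm T z v) = ((a + b) * \<eta>) * fnorm T z v"
        by (simp add: algebra_simps)
      also have "\<dots> \<le> \<epsilon> * fnorm T z v"
        by (rule mult_right_mono[OF \<eta>(2)]) simp
      finally show ?thesis unfolding eq by simp
    qed
    show "\<exists>J::'c set. \<exists>x y. finite J \<and> (\<forall>j\<in>J. x j \<in> X T \<and> y j \<in> X T) \<and>
      (\<forall>z\<in>X T. \<forall>v. fnorm T (\<lambda>l. compose (X T) RS RU z l
        - (\<Sum>j\<in>J. x j l * ip T (y j) z (head T l))) v \<le> \<epsilon> * fnorm T z v)"
    proof (rule exI[of _ D], rule exI[of _ "\<lambda>c. RS (\<delta> c)"], rule exI[of _ "\<lambda>c. RU' (\<delta> c)"],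
        intro conjI ballI allI)
      show "finite D" by (rule finD)
    qed (use dX bound in simp_all)
  qed
  then show ?thesis by (simp only: RS_def RU_def)
qed

section \<open>Amplified projections and finiteness of common extensions\<close>

lemma amp_proj:
  assumes "z \<in> X T" "l \<in> arcs A"
  shows "L.amp (proj A {l}) z = (\<lambda>c. if c \<in> arcs T \<and> L.ini c = l then z c else 0)"
proof
  fix c
  show "L.amp (proj A {l}) z c = (if c \<in> arcs T \<and> L.ini c = l then z c else 0)"
  proof (cases "c \<in> arcs T")
    case True
    have "L.slice z (L.fin c) (L.ini c) = z c"
      unfolding L.slice_apply[OF L.arc_f(2)[OF True]] L.arc_f(3)[OF True] ..
    with True L.slice_X[OF assms(1) L.arc_f(1)[OF True]] show ?thesis
      by (cases "L.ini c = l") (simp_all add: L.amp_def proj_def)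
  qed (simp add: L.amp_def)
qed

lemma compact_imp_finite_common_arcs:
  assumes l: "l \<in> arcs A" and m: "m \<in> arcs B"
    and c: "amp_comp (proj A {l}) (proj B {m}) \<in> compact_ops (CK_bimodule T)"
  shows "finite (common_arcs l m)"
proof -
  \<comment> \<open>Exchanging the two decompositions makes \<open>amp_proj\<close> available for
    the right factor as well.\<close>
  interpret flip: two_compositions B B' T g A A' f ..
  have "amp_comp (proj A {l}) (proj B {m}) = proj T (common_arcs l m)"
  proof (rule extensionalityI[of _ "X T"])
    fix z assume z: "z \<in> X T"
    have y: "R.amp (proj B {m}) z \<in> X T"
      unfolding flip.amp_proj[OF z m] by (rule X_cut(1)[OF L.wfT z])
    show "amp_comp (proj A {l}) (proj B {m}) z = proj T (common_arcs l m) z"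
      unfolding compose_eq[OF z] restrict_apply'[OF z] restrict_apply'[OF y] amp_proj[OF y l]
      unfolding flip.amp_proj[OF z m]
      unfolding proj_def restrict_apply'[OF z]
      by (rule ext) auto
  qed (simp_all add: proj_def compose_def)
  with c have "proj T (common_arcs l m) \<in> compact_ops (CK_bimodule T)" by simp
  then show ?thesis by (rule proj_compact_finite[OF L.wfT, rotated]) blast
qed

end

locale quasi_lattice_graph_system =
  quasi_lattice_ordered G P + product_system_of_graphs G P E \<phi>
  for G :: "('g, 'm) monoid_scheme" (structure) and P :: "'g set"
    and E :: "'g \<Rightarrow> ('a, 'a) pre_digraph" and \<phi> :: "'g \<Rightarrow> 'g \<Rightarrow> 'a \<times> 'a \<Rightarrow> 'a"
begin

lemma graph_composition:
  assumes pq: "p \<in> P" "q \<in> P"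
  shows "graph_composition (E p) (E q) (E (p \<otimes> q)) (\<phi> p q)"
proof (rule graph_composition.intro)
  show "wf_digraph (E p)" "wf_digraph (E q)" "wf_digraph (E (p \<otimes> q))"
    using graph pq P_mult_closed by blast+
  show "bij_betw (\<phi> p q) (arcs (fibre_product (E p) (E q))) (arcs (E (p \<otimes> q)))"
    by (rule iso_bij[OF pq])
  show "head (E (p \<otimes> q)) (\<phi> p q x) = head (E q) (snd x)"
    if "x \<in> arcs (fibre_product (E p) (E q))" for x
    using iso_head[OF pq that] by (simp add: fibre_product_def case_prod_unfold)
qed

section \<open>Degrees and joins\<close>

lemma degree_eq: "\<lbrakk>p \<in> P; c \<in> arcs (E p)\<rbrakk> \<Longrightarrow> degree P E c = p"
  unfolding degree_def using disjoint_arcs by (intro the_equality) auto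

lemma arcs_degree: "c \<in> all_arcs P E \<Longrightarrow> degree P E c \<in> P \<and> c \<in> arcs (E (degree P E c))"
  using degree_eq by (auto simp: all_arcs_def)

text \<open>The element \<open>inv a \<otimes> b\<close> and its inverse both lie in
  \<open>P\<close>, which leaves only the identity. This makes least upper bounds unique and hence
  \<open>join\<close> well defined.\<close>

lemma antisym_P:
  assumes "a \<in> carrier G" "b \<in> carrier G" "inv a \<otimes> b \<in> P" "inv b \<otimes> a \<in> P"
  shows "a = b"
proof -
  have "inv a \<otimes> b = inv (inv b \<otimes> a)" using assms by (simp add: inv_mult_group)
  then have "inv a \<otimes> b \<in> P \<inter> m_inv G ` P" using assms by blast
  then have "inv a \<otimes> b = \<one>" using P_inter_inv by blast
  then have "a \<otimes> (inv a \<otimes> b) = a" using assms by simp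
  then show ?thesis using assms by (simp add: m_assoc[symmetric])
qed

lemma join_is_lub:
  assumes "p \<in> P" "q \<in> P" "bounded_pair G P p q"
  shows "is_lub_in G P {p, q} (join G P p q)"
proof -
  have "{p, q} \<subseteq> carrier G" using assms P_subset by blast
  then obtain u where u: "is_lub_in G P {p, q} u"
    using lub_exists[of "{p, q}"] assms(3) by (auto simp: bounded_pair_def)
  have "v = u" if "is_lub_in G P {p, q} v" for v
    using u that unfolding is_lub_in_def least_def
    by (intro antisym_P) (auto simp: left_order_def)
  with u show ?thesis unfolding join_def by (rule theI)
qed

lemma join_props:
  assumes "p \<in> P" "q \<in> P" "bounded_pair G P p q"
  shows "join G P p q \<in> P" "inv p \<otimes> join G P p q \<in> P" "inv q \<otimes> join G P p q \<in> P"
    "p \<otimes> (inv p \<otimes> join G P p q) = join G P p q" "q \<otimes> (inv q \<otimes> join G P p q) = join G P p q"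
proof -
  have c: "p \<in> carrier G" "q \<in> carrier G" using assms P_subset by blast+
  have j: "join G P p q \<in> upper_bounds_in G P {p, q}"
    using join_is_lub[OF assms] by (simp add: is_lub_in_def least_def)
  then show jP: "join G P p q \<in> P" by (simp add: upper_bounds_in_def)
  show "inv p \<otimes> join G P p q \<in> P" "inv q \<otimes> join G P p q \<in> P"
    using j c by (simp_all add: upper_bounds_in_def Upper_def left_order_def)
  have "join G P p q \<in> carrier G" using jP P_subset by blast
  then show "p \<otimes> (inv p \<otimes> join G P p q) = join G P p q" "q \<otimes> (inv q \<otimes> join G P p q) = join G P p q"
    using c by (simp_all add: m_assoc[symmetric])
qed

text \<open>Writing the upper index as a product \<open>p \<otimes> r\<close> lets the composition
  of graphs be used directly; for a join \<open>t\<close> one takes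
  \<open>r = inv p \<otimes> t\<close>. Compactness of \<open>S\<close> supplies the norm bound
  under which the descriptive definition is known to have a unique solution.\<close>

lemma amplify_eq:
  assumes "p \<in> P" "r \<in> P" and Sc: "S \<in> compact_ops (CK_bimodule (E p))"
  shows "amplify G (\<lambda>p. CK_bimodule (E p)) (CK_mult G E \<phi>) p (p \<otimes> r) S =
    restrict (graph_composition.amp (E p) (E r) (E (p \<otimes> r)) (\<phi> p r) S) (X (E (p \<otimes> r)))"
proof -
  interpret graph_composition "E p" "E r" "E (p \<otimes> r)" "\<phi> p r"
    by (rule graph_composition[OF assms(1,2)])
  have r: "inv p \<otimes> (p \<otimes> r) = r"
    using assms P_subset by (simp add: m_assoc[symmetric] subset_iff)
  have m: "CK_mult G E \<phi> p r = mult"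
    by (intro ext) (simp add: CK_mult_def mult_def factorise_def ini_def fin_def fac_def
        case_prod_unfold)
  have S: "S \<in> adjointable_ops (CK_bimodule (E p))" using Sc by (simp add: compact_ops_def)
  obtain a where a: "0 \<le> a" "\<And>z v. z \<in> X (E p) \<Longrightarrow> fnorm (E p) (S z) v \<le> a * fnorm (E p) z v"
    using compact_bounded[OF wfA Sc] by blast
  show ?thesis
    unfolding amplify_def r Let_def m by (rule amp_unique[OF S a]; assumption)
qed

text \<open>Initial segments are defined through the degree of the edge itself. Once this degree is
  the join, they are the first factors in the two decompositions of \<open>E t\<close>, and the set
  becomes \<open>common_arcs\<close>.\<close>

lemma MCE_eq:
  assumes p: "p \<in> P" and q: "q \<in> P" and b: "bounded_pair G P p q"
    and m: "m \<in> arcs (E p)" and n: "n \<in> arcs (E q)"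
  defines "t \<equiv> join G P p q"
  shows "MCE G P E \<phi> m n = {c \<in> arcs (E t).
    graph_composition.ini (E p) (E (inv p \<otimes> t)) (\<phi> p (inv p \<otimes> t)) c = m \<and>
    graph_composition.ini (E q) (E (inv q \<otimes> t)) (\<phi> q (inv q \<otimes> t)) c = n}"
proof -
  note j = join_props[OF p q b, folded t_def]
  interpret L: graph_composition "E p" "E (inv p \<otimes> t)" "E t" "\<phi> p (inv p \<otimes> t)"
    using graph_composition[OF p j(2)] unfolding j(4) .
  interpret R: graph_composition "E q" "E (inv q \<otimes> t)" "E t" "\<phi> q (inv q \<otimes> t)"
    using graph_composition[OF q j(3)] unfolding j(5) .
  have 1: "c \<in> all_arcs P E \<and> degree P E c = t \<longleftrightarrow> c \<in> arcs (E t)" for c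
    using arcs_degree[of c] degree_eq[OF j(1), of c] j(1) by (auto simp: all_arcs_def)
  have d: "degree P E m = p" "degree P E n = q" using degree_eq p q m n by blast+
  have "MCE G P E \<phi> m n = {c. (c \<in> all_arcs P E \<and> degree P E c = t) \<and>
      L.ini c = m \<and> R.ini c = n}"
    unfolding MCE_def d initial_segment_def L.ini_def R.ini_def L.fac_def R.fac_def factorise_def
      t_def[symmetric]
    using b by auto
  then show ?thesis unfolding 1 by simp
qed

lemma compactly_aligned_iff:
  "compactly_aligned G P (\<lambda>p. CK_bimodule (E p)) (CK_mult G E \<phi>) \<longleftrightarrow> finitely_aligned G P E \<phi>"
proof
  assume ca: "compactly_aligned G P (\<lambda>p. CK_bimodule (E p)) (CK_mult G E \<phi>)"
  show "finitely_aligned G P E \<phi>"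
    unfolding finitely_aligned_def
  proof (intro ballI)
    fix m n assume "m \<in> all_arcs P E" "n \<in> all_arcs P E"
    define p q t where "p = degree P E m" and "q = degree P E n" and "t = join G P p q"
    have p: "p \<in> P" "m \<in> arcs (E p)" and q: "q \<in> P" "n \<in> arcs (E q)"
      using arcs_degree \<open>m \<in> _\<close> \<open>n \<in> _\<close> by (simp_all add: p_def q_def)
    show "finite (MCE G P E \<phi> m n)"
    proof (cases "bounded_pair G P p q")
      case True
      note j = join_props[OF p(1) q(1) True, folded t_def]
      interpret two_compositions "E p" "E (inv p \<otimes> t)" "E t" "\<phi> p (inv p \<otimes> t)"
        "E q" "E (inv q \<otimes> t)" "\<phi> q (inv q \<otimes> t)"
        using graph_composition[OF p(1) j(2)] graph_composition[OF q(1) j(3)]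
        unfolding j(4,5) two_compositions_def by blast
      note S = proj_singleton_compact[OF L.wfA p(2)] and U = proj_singleton_compact[OF R.wfA q(2)]
      have "amp_comp (proj (E p) {m}) (proj (E q) {n}) \<in> compact_ops (CK_bimodule (E t))"
        using ca[unfolded compactly_aligned_def Let_def, rule_format, OF p(1) q(1) True, folded t_def, OF S U]
          amplify_eq[OF p(1) j(2) S] amplify_eq[OF q(1) j(3) U]
        unfolding j(4,5) by simp
      then show ?thesis
        unfolding MCE_eq[OF p(1) q(1) True p(2) q(2), folded t_def]
        by (rule compact_imp_finite_common_arcs[OF p(2) q(2)])
    next
      case False
      then have "MCE G P E \<phi> m n = {}" by (simp add: MCE_def p_def q_def)
      then show ?thesis by simp
    qed
  qed
next
  assume fa: "finitely_aligned G P E \<phi>"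
  show "compactly_aligned G P (\<lambda>p. CK_bimodule (E p)) (CK_mult G E \<phi>)"
    unfolding compactly_aligned_def Let_def
  proof (intro ballI impI)
    fix p q S U
    assume p: "p \<in> P" and q: "q \<in> P" and b: "bounded_pair G P p q"
      and S: "S \<in> compact_ops (CK_bimodule (E p))" and U: "U \<in> compact_ops (CK_bimodule (E q))"
    define t where "t = join G P p q"
    note j = join_props[OF p q b, folded t_def]
    interpret two_compositions "E p" "E (inv p \<otimes> t)" "E t" "\<phi> p (inv p \<otimes> t)"
      "E q" "E (inv q \<otimes> t)" "\<phi> q (inv q \<otimes> t)"
      using graph_composition[OF p j(2)] graph_composition[OF q j(3)]
      unfolding j(4,5) two_compositions_def by blast
    have "finite (common_arcs m n)" if "m \<in> arcs (E p)" "n \<in> arcs (E q)" for m n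
    proof -
      have "m \<in> all_arcs P E" "n \<in> all_arcs P E" using that p q by (auto simp: all_arcs_def)
      then have "finite (MCE G P E \<phi> m n)" using fa by (simp add: finitely_aligned_def)
      then show ?thesis unfolding MCE_eq[OF p q b that, folded t_def] .
    qed
    then have "amp_comp S U \<in> compact_ops (CK_bimodule (E t))"
      by (rule finite_common_arcs_imp_compact[OF S U]; assumption?)
    then show "compose (X (E (join G P p q)))
        (amplify G (\<lambda>p. CK_bimodule (E p)) (CK_mult G E \<phi>) p (join G P p q) S)
        (amplify G (\<lambda>p. CK_bimodule (E p)) (CK_mult G E \<phi>) q (join G P p q) U)
        \<in> compact_ops (CK_bimodule (E (join G P p q)))"
      using amplify_eq[OF p j(2) S] amplify_eq[OF q j(3) U]
      unfolding j(4,5) t_def[symmetric] by simp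
  qed
qed

end

theorem theorem5p4:
  fixes G :: "('g, 'm) monoid_scheme"
    and P :: "'g set"
    and E :: "'g \<Rightarrow> ('a, 'a) pre_digraph"
    and \<phi> :: "'g \<Rightarrow> 'g \<Rightarrow> 'a \<times> 'a \<Rightarrow> 'a"
  assumes "quasi_lattice_ordered G P"
    and "product_system_of_graphs G P E \<phi>"
  shows "compactly_aligned G P (\<lambda>p. CK_bimodule (E p)) (CK_mult G E \<phi>)
    \<longleftrightarrow> finitely_aligned G P E \<phi>"
proof -
  interpret quasi_lattice_graph_system G P E \<phi>
    using assms by (rule quasi_lattice_graph_system.intro)
  show ?thesis by (rule compactly_aligned_iff)
qed

end
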